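(* Let $0<\varepsilon\leq 1$. Assuming the Exponential Time Hypothesis ($\mathsf{ETH}$), there is no algorithm that solves $(2-\varepsilon)$-$\mathsf{GapSVP}_{\mathrm{par}}$ in time $2^{2^{o(p)}}\cdot 2^{o(n)}$, where $n$ is the rank of the input lattice and $p\in\mathbb{N}$ is the norm parameter, which is part of the input.
   Context: $\mathbb{N}$ denotes the positive integers. A lattice $\mathcal{L}$ of rank $n$ and dimension $m$ is the set $\mathcal{L}(\mathbf{b}_1,\ldots,\mathbf{b}_n)=\{\sum_{i=1}^n y_i\mathbf{b}_i : y_1,\ldots,y_n\in\mathbb{Z}\}$ of all integer linear combinations of linearly independent vectors $\mathbf{b}_1,\ldots,\mathbf{b}_n\in\mathbb{R}^m$. For $1\le p<\infty$, $\|\mathbf{x}\|_p=(\sum_i |x_i|^p)^{1/p}$. Let $\lambda_{1,p}(\mathcal{L})=\min_{\mathbf{v}\in\mathcal{L}\setminus\{0\}}\|\mathbf{v}\|_p$. For $\gamma\ge 1$, the promise problem $\gamma$-$\mathsf{GapSVP}_{\mathrm{par}}$ is: given a lattice $\mathcal{L}$ of rank $n$, a distance threshold $\delta>0$, and the parameter $p\in\mathbb{N}$, decide whether $\lambda_{1,p}(\mathcal{L})\le\delta$ (YES-instance) or $\lambda_{1,p}(\mathcal{L})>\gamma\delta$ (NO-instance), when one of these cases is promised to hold. $\mathsf{ETH}$ is the hypothesis that 3-SAT on formulas with $n$ variables cannot be solved in time $2^{o(n)}$. Cost convention: all running times treat arithmetic and bitwise operations on $O(L)$-bit integers as unit-cost,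 where $L$ is the maximum bit-length of any integer appearing in the instance encoding. *)

theory Defs
  imports
    "Jordan_Normal_Form.VS_Connect"
    "HOL-Library.Log_Nat"
    "HOL-Library.Landau_Symbols"
begin

section \<open>Lattices and GapSVP\<close>

text \<open>The columns of \<open>B\<close>, an \<open>m \<times> n\<close> matrix, are the basis vectors; \<open>m\<close> is the dimension,
  \<open>n\<close> the rank.\<close>

definition is_lattice_basis :: "real mat \<Rightarrow> bool" where
  "is_lattice_basis B \<longleftrightarrow>
     distinct (cols B) \<and>
     module.lin_indpt class_ring (module_vec TYPE(real) (dim_row B)) (set (cols B))"

definition lattice_of :: "real mat \<Rightarrow> real vec set" where
  "lattice_of B =
     {B *\<^sub>v y | y. y \<in> carrier_vec (dim_col B) \<and> (\<forall>i < dim_col B. y $ i \<in> \<int>)}"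

definition lp_norm :: "real \<Rightarrow> real vec \<Rightarrow> real" where
  "lp_norm p v = (\<Sum>i < dim_vec v. \<bar>v $ i\<bar> powr p) powr (1 / p)"

definition lambda1 :: "real \<Rightarrow> real vec set \<Rightarrow> real" where
  "lambda1 p L = (LEAST r. \<exists>v \<in> L. v \<noteq> 0\<^sub>v (dim_vec v) \<and> r = lp_norm p v)"

text \<open>Inputs have to be finite objects, so bases and thresholds are rational.\<close>

record svp_instance =
  basis :: "rat mat"
  threshold :: rat
  norm_param :: nat

definition svp_rank :: "svp_instance \<Rightarrow> nat" where
  "svp_rank I = dim_col (basis I)"

definition svp_real_basis :: "svp_instance \<Rightarrow> real mat" where
  "svp_real_basis I = map_mat real_of_rat (basis I)"

definition valid_svp :: "svp_instance \<Rightarrow> bool" where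
  "valid_svp I \<longleftrightarrow>
     svp_rank I \<ge> 1 \<and> is_lattice_basis (svp_real_basis I) \<and> threshold I > 0 \<and> norm_param I \<ge> 1"

definition svp_lambda1 :: "svp_instance \<Rightarrow> real" where
  "svp_lambda1 I = lambda1 (real (norm_param I)) (lattice_of (svp_real_basis I))"

text \<open>A promise problem is the pair of its YES- and its NO-instances.\<close>

type_synonym 'i promise_problem = "'i set \<times> 'i set"

definition gap_svp_par :: "real \<Rightarrow> svp_instance promise_problem" where
  "gap_svp_par \<gamma> =
     ({I. valid_svp I \<and> svp_lambda1 I \<le> real_of_rat (threshold I)},
      {I. valid_svp I \<and> svp_lambda1 I > \<gamma> * real_of_rat (threshold I)})"

text \<open>An instance is given to a machine as a list of integers. Rationals are given as numerator
  and denominator in lowest terms; the basis is listed vector by vector.\<close>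

definition enc_rat :: "rat \<Rightarrow> int list" where
  "enc_rat q = [fst (quotient_of q), snd (quotient_of q)]"

definition enc_svp :: "svp_instance \<Rightarrow> int list" where
  "enc_svp I =
     [int (norm_param I), int (dim_col (basis I)), int (dim_row (basis I))] @
     enc_rat (threshold I) @
     concat (map (\<lambda>b. concat (map enc_rat (list_of_vec b))) (cols (basis I)))"


section \<open>3-SAT\<close>

text \<open>The variables are \<open>1, \<dots>, num_vars\<close>; the literals of variable \<open>i\<close> are the integers \<open>i\<close> and
  \<open>-i\<close>. A literal may be repeated within a clause, so shorter clauses are covered. As no clause is
  listed twice, the length of a formula is polynomial in \<open>num_vars\<close>; without this, the time needed
  to read the formula would not be bounded in terms of \<open>num_vars\<close>.\<close>

record cnf3 =
  num_vars :: nat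
  clauses :: "(int \<times> int \<times> int) list"

definition valid_lit :: "nat \<Rightarrow> int \<Rightarrow> bool" where
  "valid_lit n l \<longleftrightarrow> l \<noteq> 0 \<and> \<bar>l\<bar> \<le> int n"

definition valid_cnf3 :: "cnf3 \<Rightarrow> bool" where
  "valid_cnf3 \<phi> \<longleftrightarrow>
     distinct (clauses \<phi>) \<and>
     (\<forall>(a, b, c) \<in> set (clauses \<phi>).
        valid_lit (num_vars \<phi>) a \<and> valid_lit (num_vars \<phi>) b \<and> valid_lit (num_vars \<phi>) c)"

definition lit_true :: "(nat \<Rightarrow> bool) \<Rightarrow> int \<Rightarrow> bool" where
  "lit_true v l \<longleftrightarrow> (if l > 0 then v (nat l) else \<not> v (nat (- l)))"

definition satisfiable :: "cnf3 \<Rightarrow> bool" where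
  "satisfiable \<phi> \<longleftrightarrow>
     (\<exists>v. \<forall>(a, b, c) \<in> set (clauses \<phi>). lit_true v a \<or> lit_true v b \<or> lit_true v c)"

definition three_sat :: "cnf3 promise_problem" where
  "three_sat = ({\<phi>. valid_cnf3 \<phi> \<and> satisfiable \<phi>}, {\<phi>. valid_cnf3 \<phi> \<and> \<not> satisfiable \<phi>})"

definition enc_cnf3 :: "cnf3 \<Rightarrow> int list" where
  "enc_cnf3 \<phi> =
     [int (num_vars \<phi>), int (length (clauses \<phi>))] @
     concat (map (\<lambda>(a, b, c). [a, b, c]) (clauses \<phi>))"


section \<open>Algorithms and running time\<close>

text \<open>Algorithms are structured programs of a random access machine whose storage consists of
  integer registers and unbounded integer arrays, both named by natural numbers. A program
  mentions only finitely many of them.\<close>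

datatype binop =
  OpAdd | OpSub | OpMul | OpDiv | OpMod | OpAnd | OpOr | OpXor | OpShl | OpShr | OpLess | OpEq

datatype expr = Lit int | Reg nat | Arr nat expr | Bin binop expr expr

datatype prog =
    Skip
  | Assign nat expr
  | Store nat expr expr
  | Seq prog prog
  | If expr prog prog
  | While expr prog

record state =
  regs :: "nat \<Rightarrow> int"
  arrs :: "nat \<Rightarrow> int \<Rightarrow> int"

fun apply_op :: "binop \<Rightarrow> int \<Rightarrow> int \<Rightarrow> int" where
  "apply_op OpAdd x y = x + y"
| "apply_op OpSub x y = x - y"
| "apply_op OpMul x y = x * y"
| "apply_op OpDiv x y = x div y"
| "apply_op OpMod x y = x mod y"
| "apply_op OpAnd x y = and x y"
| "apply_op OpOr x y = or x y"
| "apply_op OpXor x y = xor x y"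
| "apply_op OpShl x y = push_bit (nat y) x"
| "apply_op OpShr x y = drop_bit (nat y) x"
| "apply_op OpLess x y = of_bool (x < y)"
| "apply_op OpEq x y = of_bool (x = y)"

fun value_of :: "state \<Rightarrow> expr \<Rightarrow> int" where
  "value_of s (Lit k) = k"
| "value_of s (Reg r) = regs s r"
| "value_of s (Arr a e) = arrs s a (value_of s e)"
| "value_of s (Bin f e e') = apply_op f (value_of s e) (value_of s e')"

definition bit_length :: "int \<Rightarrow> nat" where
  "bit_length x = max 1 (nat (bitlen \<bar>x\<bar>))"

text \<open>With word length \<open>L\<close>, an integer of bit-length \<open>l\<close> occupies \<open>\<lceil>l / L\<rceil>\<close> words, and an operation
  is charged for the words of its operands and of its result. Operations on integers of \<open>O(L)\<close>
  bits thus have cost \<open>O(1)\<close>, and larger integers, which the unit-cost convention leaves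
  unspecified, are paid for word by word.\<close>

definition words :: "nat \<Rightarrow> int \<Rightarrow> nat" where
  "words L x = (bit_length x + L - 1) div L"

fun cost_of :: "nat \<Rightarrow> state \<Rightarrow> expr \<Rightarrow> nat" where
  "cost_of L s (Lit k) = words L k"
| "cost_of L s (Reg r) = words L (regs s r)"
| "cost_of L s (Arr a e) = cost_of L s e + words L (value_of s (Arr a e))"
| "cost_of L s (Bin f e e') = cost_of L s e + cost_of L s e' + words L (value_of s (Bin f e e'))"

text \<open>\<open>exec L P s t s'\<close>: with word length \<open>L\<close>, program \<open>P\<close> started in \<open>s\<close> halts in \<open>s'\<close> after time \<open>t\<close>.\<close>

inductive exec :: "nat \<Rightarrow> prog \<Rightarrow> state \<Rightarrow> nat \<Rightarrow> state \<Rightarrow> bool" for L where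
  Skip: "exec L Skip s 1 s"
| Assign: "exec L (Assign r e) s (1 + cost_of L s e) (s\<lparr>regs := (regs s)(r := value_of s e)\<rparr>)"
| Store: "exec L (Store a e e') s (1 + cost_of L s e + cost_of L s e')
    (s\<lparr>arrs := (arrs s)(a := (arrs s a)(value_of s e := value_of s e'))\<rparr>)"
| Seq: "exec L P s t s' \<Longrightarrow> exec L Q s' t' s'' \<Longrightarrow> exec L (Seq P Q) s (t + t') s''"
| IfTrue: "value_of s e \<noteq> 0 \<Longrightarrow> exec L P s t s' \<Longrightarrow>
    exec L (If e P Q) s (1 + cost_of L s e + t) s'"
| IfFalse: "value_of s e = 0 \<Longrightarrow> exec L Q s t s' \<Longrightarrow>
    exec L (If e P Q) s (1 + cost_of L s e + t) s'"
| WhileFalse: "value_of s e = 0 \<Longrightarrow> exec L (While e P) s (1 + cost_of L s e) s"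
| WhileTrue: "value_of s e \<noteq> 0 \<Longrightarrow> exec L P s t s' \<Longrightarrow> exec L (While e P) s' t' s'' \<Longrightarrow>
    exec L (While e P) s (1 + cost_of L s e + t + t') s''"

inductive_cases exec_SkipE: "exec L Skip s t s'"
inductive_cases exec_AssignE: "exec L (Assign r e) s t s'"
inductive_cases exec_StoreE: "exec L (Store a e e') s t s'"
inductive_cases exec_SeqE: "exec L (Seq P Q) s t s'"
inductive_cases exec_IfE: "exec L (If e P Q) s t s'"
inductive_cases exec_WhileE: "exec L (While e P) s t s'"

lemma exec_deterministic:
  assumes "exec L P s t s'" "exec L P s u s''"
  shows "t = u \<and> s' = s''"
  using assms
proof (induction arbitrary: u s'' rule: exec.induct)
  case (Skip s)
  then show ?case by (elim exec_SkipE) simp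
next
  case (Assign r e s)
  then show ?case by (elim exec_AssignE) simp
next
  case (Store a e e' s)
  then show ?case by (elim exec_StoreE) simp
next
  case (Seq P s t s' Q t' s1)
  from Seq.prems obtain u1 z u2
    where "u = u1 + u2" "exec L P s u1 z" "exec L Q z u2 s''"
    by (rule exec_SeqE)
  with Seq.IH(1)[of u1 z] Seq.IH(2)[of u2 s''] show ?case by simp
next
  case (IfTrue s e P t s' Q)
  from IfTrue.prems IfTrue.hyps(1) obtain u1
    where "u = Suc (cost_of L s e + u1)" "exec L P s u1 s''"
    by (elim exec_IfE) simp_all
  with IfTrue.IH[of u1 s''] show ?case by simp
next
  case (IfFalse s e Q t s' P)
  from IfFalse.prems IfFalse.hyps(1) obtain u1
    where "u = Suc (cost_of L s e + u1)" "exec L Q s u1 s''"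
    by (elim exec_IfE) simp_all
  with IfFalse.IH[of u1 s''] show ?case by simp
next
  case (WhileFalse s e P)
  from WhileFalse.prems show ?case
    by (rule exec_WhileE) (use WhileFalse.hyps in simp_all)
next
  case (WhileTrue s e P t s' t' s1)
  from WhileTrue.prems obtain u1 z u2
    where "u = Suc (cost_of L s e + u1 + u2)" "exec L P s u1 z" "exec L (While e P) z u2 s''"
    by (rule exec_WhileE) (use WhileTrue.hyps(1) in simp_all)
  with WhileTrue.IH(1)[of u1 z] WhileTrue.IH(2)[of u2 s''] show ?case by simp
qed

definition input_state :: "int list \<Rightarrow> state" where
  "input_state xs =
     \<lparr>regs = (\<lambda>_. 0),
      arrs = (\<lambda>a i. if a = 0 \<and> 0 \<le> i \<and> i < int (length xs) then xs ! nat i else 0)\<rparr>"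

definition word_length :: "int list \<Rightarrow> nat" where
  "word_length xs = Max (insert 1 (bit_length ` set xs))"

text \<open>Rank and norm parameter of a GapSVP instance bound neither its dimension nor its bit-lengths.
  Running times stated in terms of the former are therefore understood, as usual, up to a factor
  polynomial in the size of the input; otherwise they would not even allow reading it.\<close>

definition encoding_size :: "int list \<Rightarrow> nat" where
  "encoding_size xs = (\<Sum>x\<leftarrow>xs. bit_length x)"

text \<open>\<open>P\<close> halts on \<open>xs\<close> within time \<open>T\<close> and answers YES iff \<open>ans\<close>; the answer is read from register 0.\<close>

definition answers_within :: "prog \<Rightarrow> int list \<Rightarrow> real \<Rightarrow> bool \<Rightarrow> bool" where
  "answers_within P xs T ans \<longleftrightarrow>
     (\<exists>t s. exec (word_length xs) P (input_state xs) t s \<and> real t \<le> T \<and> (regs s 0 \<noteq> 0 \<longleftrightarrow> ans))"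

definition solves_in_time ::
    "prog \<Rightarrow> ('i \<Rightarrow> int list) \<Rightarrow> 'i promise_problem \<Rightarrow> ('i \<Rightarrow> real) \<Rightarrow> bool" where
  "solves_in_time P enc A T \<longleftrightarrow>
     (\<forall>x \<in> fst A. answers_within P (enc x) (T x) True) \<and>
     (\<forall>x \<in> snd A. answers_within P (enc x) (T x) False)"

definition ETH :: bool where
  "ETH \<longleftrightarrow>
     \<not> (\<exists>P g. g \<in> o(\<lambda>n. real n) \<and>
          solves_in_time P enc_cnf3 three_sat (\<lambda>\<phi>. 2 powr g (num_vars \<phi>)))"

end

theory Submission
  imports Defs "Jordan_Normal_Form.DL_Rank" "HOL-Real_Asymp.Real_Asymp"
begin

text \<open>
  A formula with variables \<open>x\<^sub>1, \<dots>, x\<^sub>n\<close> becomes an integer lattice of rank \<open>n + 1\<close>: the integer vector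
  \<open>y\<close> is mapped to the entries \<open>2 y\<^sub>i - y\<^sub>0\<close> for \<open>0 \<le> i \<le> n\<close> and, for every clause, to
  \<open>l\<^sub>1 + l\<^sub>2 + l\<^sub>3 - 2 y\<^sub>0\<close>, where a literal stands for \<open>y\<^sub>i\<close> or \<open>y\<^sub>0 - y\<^sub>i\<close>. If all entries of a nonzero
  vector are at most \<open>1\<close> in absolute value, then \<open>y\<^sub>0 = \<plusminus>1\<close>, all \<open>y\<^sub>i / y\<^sub>0\<close> are in \<open>{0, 1}\<close>, and they
  satisfy the formula; otherwise some entry is at least \<open>2\<close>. Hence the maximum norm has gap \<open>2\<close>. As
  the dimension is \<open>O(n\<^sup>3)\<close>, the norm with \<open>p = \<Theta>(log n)\<close> differs from it only by a factor
  \<open>1 + 1 / c\<close>, with \<open>c\<close> a constant depending on \<open>\<epsilon>\<close>. For such \<open>p\<close>, the time \<open>2\<close> to the power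
  \<open>2\<^bsup>o(p)\<^esup>\<close> is \<open>2\<^bsup>o(n)\<^esup>\<close>. Since only the rank has to be linear in \<open>n\<close>, no sparsification is needed.
\<close>

section \<open>Word lengths and renaming of storage\<close>

lemma bit_length_pos: "0 < bit_length x"
  by (simp add: bit_length_def)

text \<open>A number of bit-length \<open>b + 1\<close> is at least \<open>2 ^ b\<close>, which
  exceeds \<open>b\<close>. This crude bound suffices because times are only tracked up to
  polynomials.\<close>

lemma bit_length_le: "int (bit_length x) \<le> \<bar>x\<bar> + 1"
proof (cases "x = 0")
  case False
  then have "1 \<le> bitlen \<bar>x\<bar>"
    using bitlen_nonneg[of "\<bar>x\<bar>"] bitlen_eq_zero_iff[of "\<bar>x\<bar>"] by linarith
  moreover from False have "2 ^ nat (bitlen \<bar>x\<bar> - 1) \<le> \<bar>x\<bar>"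
    using bitlen_bounds[of "\<bar>x\<bar>"] by simp
  moreover have "int (nat (bitlen \<bar>x\<bar> - 1)) < 2 ^ nat (bitlen \<bar>x\<bar> - 1)"
    by (metis of_nat_less_two_power)
  ultimately show ?thesis by (simp add: bit_length_def)
qed (simp add: bit_length_def)

lemma words_le_bit_length:
  assumes "0 < L"
  shows "words L x \<le> bit_length x"
proof -
  obtain b l where b: "bit_length x = Suc b" and l: "L = Suc l"
    using assms bit_length_pos[of x] gr0_conv_Suc by metis
  have "words L x \<le> (L * bit_length x) div L"
    unfolding words_def by (rule div_le_mono) (simp add: b l)
  then show ?thesis using assms by simp
qed

lemma bit_length_le_words:
  assumes "0 < L"
  shows "bit_length x \<le> L * words L x"
proof -
  have "bit_length x + L - 1 = L * words L x + (bit_length x + L - 1) mod L"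
    unfolding words_def by simp
  moreover have "(bit_length x + L - 1) mod L < L" using assms by simp
  ultimately show ?thesis using assms by linarith
qed

lemma words_rescale:
  assumes "0 < L" "0 < L'"
  shows "words L x \<le> L' * words L' x"
  using words_le_bit_length[OF assms(1), of x] bit_length_le_words[OF assms(2), of x] by linarith

lemma cost_of_rescale:
  assumes "0 < L" "0 < L'"
  shows "cost_of L s e \<le> L' * cost_of L' s e"
proof (induction e)
  case (Arr a e)
  then show ?case using words_rescale[OF assms, of "value_of s (Arr a e)"]
    by (simp add: distrib_left)
next
  case (Bin f e e')
  then show ?case using words_rescale[OF assms, of "value_of s (Bin f e e')"]
    by (simp add: distrib_left)
qed (simp_all add: words_rescale[OF assms])

text \<open>A number fills at most as many words as it has bits, and a word of length
  \<open>L'\<close> holds only \<open>L'\<close> bits, so every single charge grows by at most the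
  factor \<open>L'\<close>. This is what allows a solver timed at the word length of its own input
  to be run inside a program timed at another one.\<close>

lemma exec_rescale:
  assumes "exec L' P s t s'" and "0 < L" "0 < L'"
  shows "\<exists>u. exec L P s u s' \<and> u \<le> L' * t"
  using assms
proof (induction rule: exec.induct)
  case (Skip s)
  then show ?case by (intro exI[of _ 1]) (simp add: exec.Skip[simplified])
next
  case (Assign r e s)
  then show ?case using cost_of_rescale[of L L' s e]
    by (intro exI[of _ "1 + cost_of L s e"] conjI exec.Assign) simp
next
  case (Store a e e' s)
  then show ?case using cost_of_rescale[of L L' s e] cost_of_rescale[of L L' s e']
    by (intro exI[of _ "1 + cost_of L s e + cost_of L s e'"] conjI exec.Store)
      (simp add: distrib_left)
next
  case (Seq P s t s' Q t' s'')
  then obtain u u' where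
    "exec L P s u s'" "u \<le> L' * t" "exec L Q s' u' s''" "u' \<le> L' * t'" by blast
  then show ?case
    by (intro exI[of _ "u + u'"] conjI exec.Seq) (auto simp: distrib_left)
next
  case (IfTrue s e P t s' Q)
  then obtain u where "exec L P s u s'" "u \<le> L' * t" by blast
  then show ?case using IfTrue.hyps(1) IfTrue.prems cost_of_rescale[of L L' s e]
    by (intro exI[of _ "1 + cost_of L s e + u"] conjI exec.IfTrue) (auto simp: distrib_left)
next
  case (IfFalse s e Q t s' P)
  then obtain u where "exec L Q s u s'" "u \<le> L' * t" by blast
  then show ?case using IfFalse.hyps(1) IfFalse.prems cost_of_rescale[of L L' s e]
    by (intro exI[of _ "1 + cost_of L s e + u"] conjI exec.IfFalse) (auto simp: distrib_left)
next
  case (WhileFalse s e P)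
  then show ?case using cost_of_rescale[of L L' s e]
    by (intro exI[of _ "1 + cost_of L s e"] conjI exec.WhileFalse) auto
next
  case (WhileTrue s e P t s' t' s'')
  then obtain u u' where
    "exec L P s u s'" "u \<le> L' * t" "exec L (While e P) s' u' s''" "u' \<le> L' * t'" by blast
  then show ?case using WhileTrue.hyps(1) WhileTrue.prems cost_of_rescale[of L L' s e]
    by (intro exI[of _ "1 + cost_of L s e + u + u'"] conjI exec.WhileTrue[of s e L P u s'])
      (auto simp: distrib_left)
qed

section \<open>Running a program on renamed registers and arrays\<close>

fun rename_expr :: "(nat \<Rightarrow> nat) \<Rightarrow> (nat \<Rightarrow> nat) \<Rightarrow> expr \<Rightarrow> expr" where
  "rename_expr \<rho> \<sigma> (Lit k) = Lit k"
| "rename_expr \<rho> \<sigma> (Reg r) = Reg (\<rho> r)"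
| "rename_expr \<rho> \<sigma> (Arr a e) = Arr (\<sigma> a) (rename_expr \<rho> \<sigma> e)"
| "rename_expr \<rho> \<sigma> (Bin f e e') = Bin f (rename_expr \<rho> \<sigma> e) (rename_expr \<rho> \<sigma> e')"

fun rename_prog :: "(nat \<Rightarrow> nat) \<Rightarrow> (nat \<Rightarrow> nat) \<Rightarrow> prog \<Rightarrow> prog" where
  "rename_prog \<rho> \<sigma> Skip = Skip"
| "rename_prog \<rho> \<sigma> (Assign r e) = Assign (\<rho> r) (rename_expr \<rho> \<sigma> e)"
| "rename_prog \<rho> \<sigma> (Store a e e') = Store (\<sigma> a) (rename_expr \<rho> \<sigma> e) (rename_expr \<rho> \<sigma> e')"
| "rename_prog \<rho> \<sigma> (Seq P Q) = Seq (rename_prog \<rho> \<sigma> P) (rename_prog \<rho> \<sigma> Q)"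
| "rename_prog \<rho> \<sigma> (If e P Q) = If (rename_expr \<rho> \<sigma> e) (rename_prog \<rho> \<sigma> P) (rename_prog \<rho> \<sigma> Q)"
| "rename_prog \<rho> \<sigma> (While e P) = While (rename_expr \<rho> \<sigma> e) (rename_prog \<rho> \<sigma> P)"

definition view :: "(nat \<Rightarrow> nat) \<Rightarrow> (nat \<Rightarrow> nat) \<Rightarrow> state \<Rightarrow> state" where
  "view \<rho> \<sigma> s = \<lparr>regs = regs s \<circ> \<rho>, arrs = arrs s \<circ> \<sigma>\<rparr>"

lemma value_of_rename: "value_of s (rename_expr \<rho> \<sigma> e) = value_of (view \<rho> \<sigma> s) e"
  by (induction e) (simp_all add: view_def)

lemma cost_of_rename: "cost_of L s (rename_expr \<rho> \<sigma> e) = cost_of L (view \<rho> \<sigma> s) e"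
  by (induction e) (simp_all add: view_def value_of_rename)

lemma view_update_reg:
  assumes "inj \<rho>"
  shows "view \<rho> \<sigma> (s\<lparr>regs := (regs s)(\<rho> r := x)\<rparr>) =
    (view \<rho> \<sigma> s)\<lparr>regs := (regs (view \<rho> \<sigma> s))(r := x)\<rparr>"
  using assms by (auto simp: view_def fun_eq_iff inj_eq)

lemma view_update_arr:
  assumes "inj \<sigma>"
  shows "view \<rho> \<sigma> (s\<lparr>arrs := (arrs s)(\<sigma> a := (arrs s (\<sigma> a))(i := x))\<rparr>) =
    (view \<rho> \<sigma> s)\<lparr>arrs := (arrs (view \<rho> \<sigma> s))(a := (arrs (view \<rho> \<sigma> s) a)(i := x))\<rparr>"
  using assms by (auto simp: view_def fun_eq_iff inj_eq)

text \<open>Values and costs depend only on the storage visible through the renaming. Injectivity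
  makes a renamed write change exactly one visible place, so both runs proceed in lockstep and take
  the same time.\<close>

lemma exec_rename:
  assumes "exec L P s t s'" and "inj \<rho>" "inj \<sigma>" "view \<rho> \<sigma> S = s"
  shows "\<exists>S'. exec L (rename_prog \<rho> \<sigma> P) S t S' \<and> view \<rho> \<sigma> S' = s'"
  using assms
proof (induction arbitrary: S rule: exec.induct)
  case (Skip s)
  then show ?case using exec.Skip[of L S] by auto
next
  case (Assign r e s)
  have "exec L (rename_prog \<rho> \<sigma> (Assign r e)) S (1 + cost_of L s e)
      (S\<lparr>regs := (regs S)(\<rho> r := value_of s e)\<rparr>)"
    using exec.Assign[of L "\<rho> r" "rename_expr \<rho> \<sigma> e" S] Assign.prems
    by (simp add: value_of_rename cost_of_rename)
  then show ?case using view_update_reg Assign.prems by blast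
next
  case (Store a e e' s)
  have "exec L (rename_prog \<rho> \<sigma> (Store a e e')) S (1 + cost_of L s e + cost_of L s e')
      (S\<lparr>arrs := (arrs S)(\<sigma> a := (arrs S (\<sigma> a))(value_of s e := value_of s e'))\<rparr>)"
    using exec.Store[of L "\<sigma> a" "rename_expr \<rho> \<sigma> e" "rename_expr \<rho> \<sigma> e'" S] Store.prems
    by (simp add: value_of_rename cost_of_rename)
  then show ?case using view_update_arr Store.prems by blast
next
  case (Seq P s t s' Q t' s'')
  from Seq.IH(1)[OF Seq.prems] obtain S' where
    1: "exec L (rename_prog \<rho> \<sigma> P) S t S'" "view \<rho> \<sigma> S' = s'" by blast
  from Seq.IH(2)[OF Seq.prems(1,2) 1(2)] 1(1) show ?case by (auto intro: exec.Seq)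
next
  case (IfTrue s e P t s' Q)
  from IfTrue.IH[OF IfTrue.prems] obtain S' where
    "exec L (rename_prog \<rho> \<sigma> P) S t S'" "view \<rho> \<sigma> S' = s'" by blast
  then show ?case
    using exec.IfTrue[of S "rename_expr \<rho> \<sigma> e" L "rename_prog \<rho> \<sigma> P" t S' "rename_prog \<rho> \<sigma> Q"]
      IfTrue.hyps(1) IfTrue.prems by (auto simp: value_of_rename cost_of_rename)
next
  case (IfFalse s e Q t s' P)
  from IfFalse.IH[OF IfFalse.prems] obtain S' where
    "exec L (rename_prog \<rho> \<sigma> Q) S t S'" "view \<rho> \<sigma> S' = s'" by blast
  then show ?case
    using exec.IfFalse[of S "rename_expr \<rho> \<sigma> e" L "rename_prog \<rho> \<sigma> Q" t S' "rename_prog \<rho> \<sigma> P"]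
      IfFalse.hyps(1) IfFalse.prems by (auto simp: value_of_rename cost_of_rename)
next
  case (WhileFalse s e P)
  then show ?case
    using exec.WhileFalse[of S "rename_expr \<rho> \<sigma> e" L "rename_prog \<rho> \<sigma> P"]
    by (auto simp: value_of_rename cost_of_rename)
next
  case (WhileTrue s e P t s' t' s'')
  from WhileTrue.IH(1)[OF WhileTrue.prems] obtain S' where
    1: "exec L (rename_prog \<rho> \<sigma> P) S t S'" "view \<rho> \<sigma> S' = s'" by blast
  from WhileTrue.IH(2)[OF WhileTrue.prems(1,2) 1(2)] obtain S'' where
    2: "exec L (rename_prog \<rho> \<sigma> (While e P)) S' t' S''" "view \<rho> \<sigma> S'' = s''" by blast
  show ?case
    using exec.WhileTrue[of S "rename_expr \<rho> \<sigma> e" L "rename_prog \<rho> \<sigma> P" t S' t' S''] 1 2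
      WhileTrue.hyps(1) WhileTrue.prems by (auto simp: value_of_rename cost_of_rename)
qed

section \<open>Polynomial running times\<close>

text \<open>The operations kept here have results of polynomial size in their operands, whereas a
  left shift can produce exponentially large values.\<close>

fun simple_expr :: "expr \<Rightarrow> bool" where
  "simple_expr (Lit k) \<longleftrightarrow> True"
| "simple_expr (Reg r) \<longleftrightarrow> True"
| "simple_expr (Arr a e) \<longleftrightarrow> simple_expr e"
| "simple_expr (Bin f e e') \<longleftrightarrow>
     f \<in> {OpAdd, OpSub, OpMul, OpDiv, OpMod, OpLess, OpEq} \<and> simple_expr e \<and> simple_expr e'"

text \<open>For \<open>B \<ge> 2\<close> bounding the storage, \<open>B ^ d\<close> with the following degrees \<open>d\<close> bounds values, costs
  and, if all loops make at most \<open>B\<close> iterations, running times. The degree of a numeral \<open>k\<close> comes from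
  \<open>\<bar>k\<bar> \<le> 2 ^ \<bar>k\<bar>\<close>.\<close>

fun value_degree :: "expr \<Rightarrow> nat" where
  "value_degree (Lit k) = nat \<bar>k\<bar>"
| "value_degree (Reg r) = 1"
| "value_degree (Arr a e) = 1"
| "value_degree (Bin f e e') = value_degree e + value_degree e' + 1"

fun cost_degree :: "expr \<Rightarrow> nat" where
  "cost_degree (Lit k) = nat \<bar>k\<bar> + 1"
| "cost_degree (Reg r) = 2"
| "cost_degree (Arr a e) = cost_degree e + 3"
| "cost_degree (Bin f e e') = cost_degree e + cost_degree e' + value_degree e + value_degree e' + 4"

fun prog_degree :: "prog \<Rightarrow> nat" where
  "prog_degree Skip = 1"
| "prog_degree (Assign r e) = cost_degree e + 1"
| "prog_degree (Store a e e') = cost_degree e + cost_degree e' + 2"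
| "prog_degree (Seq P Q) = prog_degree P + prog_degree Q + 1"
| "prog_degree (If e P Q) = cost_degree e + prog_degree P + prog_degree Q + 2"
| "prog_degree (While e P) = cost_degree e + prog_degree P + 4"

section \<open>Values, costs and times over bounded storage\<close>

definition bounded_state :: "nat \<Rightarrow> state \<Rightarrow> bool" where
  "bounded_state B s \<longleftrightarrow> (\<forall>r. \<bar>regs s r\<bar> \<le> int B) \<and> (\<forall>a i. \<bar>arrs s a i\<bar> \<le> int B)"

text \<open>Both summands are at most \<open>B ^ (a + b)\<close>, and the factor 2 is absorbed by
  one more \<open>B\<close>. All degrees are composed by this rule.\<close>

lemma power_add_le:
  fixes x y B :: "'a :: linordered_semidom"
  assumes "2 \<le> B" "x \<le> B ^ a" "y \<le> B ^ b"
  shows "x + y \<le> B ^ (a + b + 1)"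
proof -
  have B: "1 \<le> B" using order_trans[OF _ assms(1), of 1] by simp
  have "B ^ a \<le> B ^ (a + b)" "B ^ b \<le> B ^ (a + b)"
    by (rule power_increasing; use B in simp)+
  then have "x + y \<le> B ^ (a + b) + B ^ (a + b)"
    using assms(2,3) by (meson add_mono order_trans)
  also have "\<dots> = 2 * B ^ (a + b)" by (simp add: mult_2)
  also have "\<dots> \<le> B * B ^ (a + b)"
    using B assms(1) by (intro mult_right_mono zero_le_power) (auto intro: order_trans[of 0 1])
  finally show ?thesis by simp
qed

text \<open>For a positive divisor the floored quotient lies between 0 and the dividend. A negative
  divisor is treated by negating both operands, and division by 0 yields 0.\<close>

lemma abs_div_le: "\<bar>x div y\<bar> \<le> \<bar>x\<bar>" for x y :: int
proof -
  have pos: "\<bar>x div y\<bar> \<le> \<bar>x\<bar>" if "0 < y" for x y :: int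
  proof (cases "0 \<le> x")
    case True
    then show ?thesis using that zdiv_mono2[of x 1 y] by (simp add: pos_imp_zdiv_nonneg_iff)
  next
    case False
    have "x * y \<le> x * 1" using False that by (intro mult_left_mono_neg) auto
    then have "x * y div y \<le> x div y" using that by (intro zdiv_mono1) auto
    then show ?thesis using False that pos_imp_zdiv_neg_iff[of y x] by simp
  qed
  then show ?thesis
    using pos[of y x] pos[of "- y" "- x"] by (cases y "0 :: int" rule: linorder_cases) auto
qed

lemma abs_value_of_le:
  assumes "2 \<le> B" "bounded_state B s" "simple_expr e"
  shows "\<bar>value_of s e\<bar> \<le> int B ^ value_degree e"
  using assms(3)
proof (induction e)
  case (Lit k)
  have "\<bar>k\<bar> = int (nat \<bar>k\<bar>)" by simp
  also have "\<dots> \<le> 2 ^ nat \<bar>k\<bar>" using of_nat_less_two_power less_imp_le by blast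
  also have "\<dots> \<le> int B ^ nat \<bar>k\<bar>" using assms(1) by (intro power_mono) auto
  finally show ?case by simp
next
  case (Bin f e e')
  define x y a b where "x = value_of s e" and "y = value_of s e'"
    and "a = value_degree e" and "b = value_degree e'"
  have x: "\<bar>x\<bar> \<le> int B ^ a" and y: "\<bar>y\<bar> \<le> int B ^ b"
    using Bin by (simp_all add: x_def y_def a_def b_def)
  have sum: "\<bar>x\<bar> + \<bar>y\<bar> \<le> int B ^ (a + b + 1)"
    using power_add_le[OF _ x y] assms(1) by simp
  have one: "1 \<le> int B ^ (a + b + 1)" using assms(1) by (intro one_le_power) simp
  have "\<bar>x * y\<bar> \<le> int B ^ (a + b)"
    unfolding abs_mult power_add by (intro mult_mono x y) auto
  also have "\<dots> \<le> int B ^ (a + b + 1)" using assms(1) by (intro power_increasing) auto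
  finally have prod: "\<bar>x * y\<bar> \<le> int B ^ (a + b + 1)" .
  have "\<bar>x div y\<bar> \<le> \<bar>x\<bar>"
    by (rule abs_div_le)
  \<comment> \<open>For \<open>y = 0\<close> the remainder is \<open>x\<close> itself, hence the sum
    of both absolute values rather than \<open>\<bar>y\<bar>\<close> alone.\<close>
  moreover have "\<bar>x mod y\<bar> \<le> \<bar>x\<bar> + \<bar>y\<bar>"
    using abs_mod_less[of y x] by (cases "y = 0") auto
  ultimately show ?case using Bin.prems sum prod one
    by (auto simp flip: x_def y_def a_def b_def)
qed (use assms in \<open>auto simp: bounded_state_def\<close>)

text \<open>Uniform in the word length: a value takes at most as many words as bits, hence at most
  its absolute value plus one, which raises its degree by one.\<close>

lemma cost_of_le:
  assumes "0 < L" "2 \<le> B" "bounded_state B s" "simple_expr e"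
  shows "cost_of L s e \<le> B ^ cost_degree e"
proof -
  have words: "words L x \<le> B ^ (d + 1)" if "\<bar>x\<bar> \<le> int B ^ d" for x d
  proof -
    have "int (words L x) \<le> \<bar>x\<bar> + 1"
      using words_le_bit_length[OF assms(1), of x] bit_length_le[of x] by linarith
    also have "\<dots> \<le> int B ^ (d + 0 + 1)"
      using assms(2) that by (intro power_add_le) auto
    also have "\<dots> = int (B ^ (d + 1))" by simp
    finally show ?thesis unfolding of_nat_le_iff .
  qed
  have val: "\<bar>value_of s e'\<bar> \<le> int B ^ value_degree e'" if "simple_expr e'" for e'
    using abs_value_of_le[OF assms(2,3) that] .
  show ?thesis
    using assms(4)
  proof (induction e)
    case (Lit k)
    then show ?case using words[OF val[OF Lit]] by simp
  next
    case (Reg r)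
    then show ?case using words[OF val[OF Reg]] by (simp add: power2_eq_square)
  next
    case (Arr a e)
    have "cost_of L s e + words L (value_of s (Arr a e)) \<le> B ^ (cost_degree e + (1 + 1) + 1)"
      using Arr words[OF val[OF Arr.prems]] assms(2) by (intro power_add_le) auto
    then show ?case by (simp add: numeral_3_eq_3)
  next
    case (Bin f e e')
    let ?d = "value_degree (Bin f e e')"
    have "cost_of L s e + cost_of L s e' + words L (value_of s (Bin f e e'))
        \<le> B ^ ((cost_degree e + cost_degree e' + 1) + (?d + 1) + 1)"
      using Bin words[OF val[OF Bin.prems]] assms(2)
      by (intro power_add_le) (auto intro!: power_add_le[of B, simplified])
    also have "(cost_degree e + cost_degree e' + 1) + (?d + 1) + 1 = cost_degree (Bin f e e')"
      by simp
    finally show ?case by simp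
  qed
qed

text \<open>The exponent is determined by the program alone, so a fixed program runs in time
  polynomial in \<open>B\<close>, with the same exponent for all inputs.\<close>

definition runs :: "nat \<Rightarrow> nat \<Rightarrow> prog \<Rightarrow> state \<Rightarrow> state \<Rightarrow> bool" where
  "runs L B P s s' \<longleftrightarrow> (\<exists>t. exec L P s t s' \<and> t \<le> B ^ prog_degree P)"

lemma runs_Assign:
  assumes "0 < L" "2 \<le> B" "bounded_state B s" "simple_expr e" "value_of s e = x"
  shows "runs L B (Assign r e) s (s\<lparr>regs := (regs s)(r := x)\<rparr>)"
proof -
  have "1 + cost_of L s e \<le> B ^ (0 + cost_degree e + 1)"
    using assms cost_of_le by (intro power_add_le) auto
  then show ?thesis
    unfolding runs_def using exec.Assign[of L r e s] assms(5) by auto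
qed

lemma runs_Store:
  assumes "0 < L" "2 \<le> B" "bounded_state B s" "simple_expr e" "simple_expr e'"
    "value_of s e = i" "value_of s e' = x"
  shows "runs L B (Store a e e') s (s\<lparr>arrs := (arrs s)(a := (arrs s a)(i := x))\<rparr>)"
proof -
  have "1 + cost_of L s e \<le> B ^ (0 + cost_degree e + 1)"
    using assms cost_of_le by (intro power_add_le) auto
  then have "1 + cost_of L s e + cost_of L s e' \<le> B ^ ((0 + cost_degree e + 1) + cost_degree e' + 1)"
    using assms cost_of_le by (intro power_add_le) auto
  also have "(0 + cost_degree e + 1) + cost_degree e' + 1 = prog_degree (Store a e e')" by simp
  finally show ?thesis
    unfolding runs_def using exec.Store[of L a e e' s] assms(6,7) by blast
qed

lemma runs_Seq:
  assumes "2 \<le> B" "runs L B P s s'" "runs L B Q s' s''"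
  shows "runs L B (Seq P Q) s s''"
proof -
  obtain t t' where "exec L P s t s'" "t \<le> B ^ prog_degree P"
    and "exec L Q s' t' s''" "t' \<le> B ^ prog_degree Q"
    using assms(2,3) unfolding runs_def by blast
  moreover from this have "t + t' \<le> B ^ (prog_degree P + prog_degree Q + 1)"
    using assms(1) by (intro power_add_le)
  ultimately show ?thesis unfolding runs_def by (auto intro: exec.Seq)
qed

text \<open>\<open>S i\<close> is the state after \<open>i\<close> iterations. There are
  \<open>N + 1\<close> tests and \<open>N\<close> executions of the body, each of bounded
  cost.\<close>

lemma runs_While:
  assumes "0 < L" "2 \<le> B" "simple_expr e" "N \<le> B"
    and "\<And>i. i \<le> N \<Longrightarrow> bounded_state B (S i)"
    and "\<And>i. i < N \<Longrightarrow> value_of (S i) e \<noteq> 0"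
    and "\<And>i. i < N \<Longrightarrow> runs L B P (S i) (S (Suc i))"
    and "value_of (S N) e = 0"
  shows "runs L B (While e P) (S 0) (S N)"
proof -
  define c b where "c = B ^ cost_degree e" and "b = B ^ prog_degree P"
  have cost: "cost_of L (S i) e \<le> c" if "i \<le> N" for i
    unfolding c_def using assms that by (intro cost_of_le) auto
  \<comment> \<open>The induction runs backwards: \<open>j\<close> counts the iterations still to be
    made.\<close>
  have "\<exists>t. exec L (While e P) (S (N - j)) t (S N) \<and> t \<le> (j + 1) * (1 + c + b)" if "j \<le> N" for j
    using that
  proof (induction j)
    case 0
    then show ?case using exec.WhileFalse[OF assms(8), of L P] cost[of N] by fastforce
  next
    case (Suc j)
    then obtain u where u: "exec L (While e P) (S (N - j)) u (S N)" "u \<le> (j + 1) * (1 + c + b)"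
      by auto
    have i: "N - Suc j < N" "Suc (N - Suc j) = N - j" using Suc.prems by auto
    from assms(7)[OF i(1)] obtain t where t: "exec L P (S (N - Suc j)) t (S (N - j))" "t \<le> b"
      unfolding i(2) runs_def b_def by blast
    show ?case
      using exec.WhileTrue[OF assms(6)[OF i(1)] t(1) u(1)] cost[of "N - Suc j"] t(2) u(2)
      by (intro exI conjI) (assumption, simp)
  qed
  from this[of N] obtain t where t: "exec L (While e P) (S 0) t (S N)" "t \<le> (N + 1) * (1 + c + b)"
    by auto
  have "1 + c \<le> B ^ (0 + cost_degree e + 1)"
    using assms(2) by (intro power_add_le) (auto simp: c_def)
  then have "1 + c + b \<le> B ^ ((0 + cost_degree e + 1) + prog_degree P + 1)"
    by (rule power_add_le[OF assms(2)]) (simp add: b_def)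
  moreover have "N + 1 \<le> B ^ (1 + 0 + 1)" using assms(2,4) by (intro power_add_le) auto
  ultimately have "(N + 1) * (1 + c + b)
      \<le> B ^ (1 + 0 + 1) * B ^ ((0 + cost_degree e + 1) + prog_degree P + 1)"
    by (intro mult_mono) auto
  also have "\<dots> = B ^ prog_degree (While e P)"
    unfolding power_add[symmetric] by (rule arg_cong[of _ _ "power B"]) simp
  finally show ?thesis unfolding runs_def using t by (meson order_trans)
qed

section \<open>The lattice of a formula\<close>

text \<open>\<open>LEAST\<close> on the reals denotes a minimum only if one exists. For integral
  vectors and a natural exponent the \<open>p\<close>-th powers of the norms are natural numbers,
  which are well-ordered.\<close>

lemma lambda1_attained:
  assumes p: "1 \<le> p"
    and int: "\<And>v i. v \<in> L \<Longrightarrow> i < dim_vec v \<Longrightarrow> v $ i \<in> \<int>"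
    and ex: "\<exists>v \<in> L. v \<noteq> 0\<^sub>v (dim_vec v)"
  obtains v where "v \<in> L" "v \<noteq> 0\<^sub>v (dim_vec v)" "lambda1 (real p) L = lp_norm (real p) v"
    "\<And>w. w \<in> L \<Longrightarrow> w \<noteq> 0\<^sub>v (dim_vec w) \<Longrightarrow> lambda1 (real p) L \<le> lp_norm (real p) w"
proof -
  define f where "f v = (\<Sum>i < dim_vec v. \<bar>v $ i\<bar> powr real p)" for v :: "real vec"
  have f: "f v = real (nat \<lfloor>f v\<rfloor>)" if "v \<in> L" for v
  proof -
    have "\<bar>v $ i\<bar> powr real p \<in> \<int>" if "i < dim_vec v" for i
      using int[OF \<open>v \<in> L\<close> that] p by (cases "v $ i = 0") (auto simp: powr_realpow)
    then have "f v \<in> \<int>" unfolding f_def by (intro Ints_sum) auto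
    moreover have "0 \<le> f v" unfolding f_def by (intro sum_nonneg) auto
    ultimately show ?thesis by (auto elim!: Ints_cases)
  qed
  obtain v where v: "v \<in> L" "v \<noteq> 0\<^sub>v (dim_vec v)"
    and min: "\<And>w. w \<in> L \<Longrightarrow> w \<noteq> 0\<^sub>v (dim_vec w) \<Longrightarrow> nat \<lfloor>f v\<rfloor> \<le> nat \<lfloor>f w\<rfloor>"
    using ex ex_has_least_nat[of "\<lambda>v. v \<in> L \<and> v \<noteq> 0\<^sub>v (dim_vec v)" _ "\<lambda>v. nat \<lfloor>f v\<rfloor>"] by blast
  have le: "lp_norm (real p) v \<le> lp_norm (real p) w" if w: "w \<in> L" "w \<noteq> 0\<^sub>v (dim_vec w)" for w
  proof -
    have "f v \<le> f w" using f[OF v(1)] f[OF w(1)] min[OF w] by linarith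
    moreover have "0 \<le> f v" unfolding f_def by (intro sum_nonneg) auto
    ultimately show ?thesis unfolding lp_norm_def f_def[symmetric] by (intro powr_mono2) auto
  qed
  have "lambda1 (real p) L = lp_norm (real p) v"
    unfolding lambda1_def by (rule Least_equality) (use v le in auto)
  with v le that show ?thesis by metis
qed

lemma lp_norm_ge:
  assumes "1 \<le> p" "i < dim_vec v" "0 \<le> a" "a \<le> \<bar>v $ i\<bar>"
  shows "a \<le> lp_norm p v"
proof -
  have "a = (a powr p) powr (1 / p)" using assms by (simp add: powr_powr)
  also have "\<dots> \<le> (\<bar>v $ i\<bar> powr p) powr (1 / p)" using assms by (intro powr_mono2) auto
  also have "\<dots> \<le> lp_norm p v"
    unfolding lp_norm_def using assms by (intro powr_mono2 member_le_sum) auto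
  finally show ?thesis .
qed

text \<open>The sum of the \<open>p\<close>-th powers is at most the dimension. Together with the
  lower bound by a single entry, this compares the norm with the maximum norm.\<close>

lemma lp_norm_le:
  assumes "1 \<le> p" "\<And>i. i < dim_vec v \<Longrightarrow> \<bar>v $ i\<bar> \<le> 1" "0 \<le> d" "real (dim_vec v) \<le> d powr p"
  shows "lp_norm p v \<le> d"
proof -
  have "(\<Sum>i < dim_vec v. \<bar>v $ i\<bar> powr p) \<le> (\<Sum>i < dim_vec v. 1)"
    using assms powr_mono2[of p _ 1] by (intro sum_mono) auto
  also have "\<dots> \<le> d powr p" using assms(4) by simp
  finally have "lp_norm p v \<le> (d powr p) powr (1 / p)"
    unfolding lp_norm_def using assms(1) by (intro powr_mono2 sum_nonneg) auto
  then show ?thesis using assms(1,3) by (simp add: powr_powr)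
qed

section \<open>The basis matrix and its linear forms\<close>

definition lit_coeff :: "int \<Rightarrow> int \<Rightarrow> int" where
  "lit_coeff l v = of_bool (l = v) - of_bool (l = - v) + of_bool (v = 0) * of_bool (l < 0)"

text \<open>For \<open>y 0 = 1\<close> and an assignment, the number of true literals, 0 to 3, is
  shifted to the range from -2 to 1, so that exactly the violated clauses reach absolute value
  2.\<close>

definition clause_coeff :: "int \<times> int \<times> int \<Rightarrow> int \<Rightarrow> int" where
  "clause_coeff = (\<lambda>(a, b, c) v. lit_coeff a v + lit_coeff b v + lit_coeff c v - 2 * of_bool (v = 0))"

text \<open>Row 0 reduces to \<open>y 0\<close> and thereby bounds this coordinate itself. Clause
  \<open>j\<close> belongs to row \<open>num_vars \<phi> + 1 + j\<close>.\<close>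

definition sat_entry :: "cnf3 \<Rightarrow> nat \<Rightarrow> nat \<Rightarrow> int" where
  "sat_entry \<phi> i v =
     (if i \<le> num_vars \<phi> then 2 * of_bool (v = i) - of_bool (v = 0)
      else clause_coeff (clauses \<phi> ! (i - num_vars \<phi> - 1)) (int v))"

definition sat_dim :: "cnf3 \<Rightarrow> nat" where
  "sat_dim \<phi> = num_vars \<phi> + 1 + length (clauses \<phi>)"

definition sat_basis :: "cnf3 \<Rightarrow> rat mat" where
  "sat_basis \<phi> = mat (sat_dim \<phi>) (num_vars \<phi> + 1) (\<lambda>(i, v). of_int (sat_entry \<phi> i v))"

text \<open>The exponent depends on the number of variables only, so that the running time does as well;
  \<open>8 * (n + 1) ^ 3 \<le> 2 ^ (3 + 3 * ceillog2 (n + 1))\<close> bounds the dimension.\<close>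

definition sat_param :: "nat \<Rightarrow> nat \<Rightarrow> nat" where
  "sat_param c n = c * (3 + 3 * ceillog2 (n + 1))"

text \<open>The threshold exceeds 1 by \<open>1 / c\<close> to absorb the passage from the maximum
  norm to the \<open>p\<close>-norm.\<close>

definition sat_instance :: "nat \<Rightarrow> cnf3 \<Rightarrow> svp_instance" where
  "sat_instance c \<phi> =
     \<lparr>basis = sat_basis \<phi>, threshold = 1 + 1 / of_nat c, norm_param = sat_param c (num_vars \<phi>)\<rparr>"

definition lit_val :: "(nat \<Rightarrow> real) \<Rightarrow> int \<Rightarrow> real" where
  "lit_val z l = (if 0 < l then z (nat l) else z 0 - z (nat (- l)))"

definition row_val :: "cnf3 \<Rightarrow> (nat \<Rightarrow> real) \<Rightarrow> nat \<Rightarrow> real" where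
  "row_val \<phi> z i =
     (if i \<le> num_vars \<phi> then 2 * z i - z 0
      else (case clauses \<phi> ! (i - num_vars \<phi> - 1) of
        (a, b, c) \<Rightarrow> lit_val z a + lit_val z b + lit_val z c - 2 * z 0))"

lemma sum_of_bool_mult:
  fixes z :: "nat \<Rightarrow> real"
  assumes "k \<le> n"
  shows "(\<Sum>v\<le>n. of_bool (v = k) * z v) = z k"
  using assms by (simp add: of_bool_def if_distrib[of "\<lambda>x. x * _"] cong: if_cong)

text \<open>At \<open>v = 0\<close> the first two terms of \<open>lit_coeff\<close> cancel, and the
  third supplies the summand \<open>z 0\<close> of a negative literal.\<close>

lemma sum_lit_coeff:
  assumes "valid_lit n l"
  shows "(\<Sum>v\<le>n. real_of_int (lit_coeff l (int v)) * z v) = lit_val z l"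
proof (cases "0 < l")
  case True
  then have "lit_coeff l (int v) = of_bool (v = nat l)" for v
    by (auto simp: lit_coeff_def)
  then show ?thesis
    using True assms sum_of_bool_mult[of "nat l" n z] by (simp add: lit_val_def valid_lit_def)
next
  case False
  then have "lit_coeff l (int v) = of_bool (v = 0) - of_bool (v = nat (- l))" for v
    using assms by (auto simp: lit_coeff_def valid_lit_def)
  then show ?thesis
    using False assms sum_of_bool_mult[of "nat (- l)" n z] sum_of_bool_mult[of 0 n z]
    by (simp only: of_int_diff of_int_of_bool left_diff_distrib sum_subtractf)
      (simp only: lit_val_def valid_lit_def nat_le_iff abs_of_nonpos not_less if_not_P simp_thms zero_le)
qed

text \<open>Connects the coefficients, which the program has to write, with the linear forms in
  which the gap is argued.\<close>

lemma sum_sat_entry: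
  assumes "valid_cnf3 \<phi>" "i < sat_dim \<phi>"
  shows "(\<Sum>v\<le>num_vars \<phi>. real_of_int (sat_entry \<phi> i v) * z v) = row_val \<phi> z i"
proof (cases "i \<le> num_vars \<phi>")
  case True
  then have "real_of_int (sat_entry \<phi> i v) * z v = 2 * (of_bool (v = i) * z v) - of_bool (v = 0) * z v"
    for v by (simp add: sat_entry_def)
  then show ?thesis using True
    by (simp only: sum_subtractf sum_distrib_left[symmetric] sum_of_bool_mult) (simp add: row_val_def)
next
  case False
  define n where "n = num_vars \<phi>"
  obtain a b c where abc: "clauses \<phi> ! (i - n - 1) = (a, b, c)"
    using prod_cases3 by blast
  have "i - n - 1 < length (clauses \<phi>)" using False assms(2) by (simp add: sat_dim_def n_def)
  then have "(a, b, c) \<in> set (clauses \<phi>)" using abc nth_mem by metis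
  then have lits: "valid_lit n a" "valid_lit n b" "valid_lit n c"
    using assms(1) by (auto simp: valid_cnf3_def n_def)
  have "real_of_int (sat_entry \<phi> i v) * z v =
      lit_coeff a (int v) * z v + lit_coeff b (int v) * z v + lit_coeff c (int v) * z v -
      2 * (of_bool (v = 0) * z v)" for v
    using False abc by (simp add: sat_entry_def clause_coeff_def n_def algebra_simps)
  then have "(\<Sum>v\<le>n. real_of_int (sat_entry \<phi> i v) * z v) =
      lit_val z a + lit_val z b + lit_val z c - 2 * (\<Sum>v\<le>n. of_bool (v = 0) * z v)"
    by (simp only: sum.distrib sum_subtractf sum_distrib_left[symmetric]
        sum_lit_coeff[OF lits(1)] sum_lit_coeff[OF lits(2)] sum_lit_coeff[OF lits(3)])
  then show ?thesis
    using False abc by (simp only: sum_of_bool_mult) (simp add: row_val_def n_def)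
qed

lemma sat_basis_mult_vec:
  assumes "valid_cnf3 \<phi>" "y \<in> carrier_vec (num_vars \<phi> + 1)"
  shows "map_mat real_of_rat (sat_basis \<phi>) *\<^sub>v y = vec (sat_dim \<phi>) (row_val \<phi> (($) y))"
proof (rule eq_vecI)
  fix i assume "i < dim_vec (vec (sat_dim \<phi>) (row_val \<phi> (($) y)))"
  then have i: "i < sat_dim \<phi>" by simp
  have "(map_mat real_of_rat (sat_basis \<phi>) *\<^sub>v y) $ i =
      (\<Sum>v\<le>num_vars \<phi>. real_of_int (sat_entry \<phi> i v) * y $ v)"
    using i assms(2) by (simp add: sat_basis_def scalar_prod_def lessThan_Suc_atMost[symmetric]
        atLeast0LessThan)
  then show "(map_mat real_of_rat (sat_basis \<phi>) *\<^sub>v y) $ i = vec (sat_dim \<phi>) (row_val \<phi> (($) y)) $ i"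
    using sum_sat_entry[OF assms(1) i] i by simp
qed (simp add: sat_basis_def)

text \<open>The rows of the variables already force a trivial kernel: row 0 gives
  \<open>y 0 = 0\<close>, and then row \<open>i\<close> gives \<open>y i = 0\<close>.\<close>

lemma is_lattice_basis_sat_basis:
  assumes "valid_cnf3 \<phi>"
  shows "is_lattice_basis (map_mat real_of_rat (sat_basis \<phi>))"
proof -
  let ?B = "map_mat real_of_rat (sat_basis \<phi>)"
  let ?n = "num_vars \<phi>"
  have B: "?B \<in> carrier_mat (sat_dim \<phi>) (?n + 1)" by (simp add: sat_basis_def)
  have inj: "y = 0\<^sub>v (?n + 1)"
    if y: "y \<in> carrier_vec (?n + 1)" and zero: "?B *\<^sub>v y = 0\<^sub>v (sat_dim \<phi>)" for y
  proof -
    have row: "2 * y $ i - y $ 0 = 0" if "i \<le> ?n" for i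
    proof -
      have "i < sat_dim \<phi>" using that by (simp add: sat_dim_def)
      then show ?thesis
        using arg_cong[OF zero, of "\<lambda>w. w $ i"] that
        by (simp add: sat_basis_mult_vec[OF assms y] row_val_def)
    qed
    from row[of 0] have "y $ 0 = 0" by simp
    with row have "y $ i = 0" if "i \<le> ?n" for i using that by fastforce
    with y show ?thesis by (intro eq_vecI) auto
  qed
  have "distinct (cols ?B)"
  proof (rule ccontr)
    assume "\<not> distinct (cols ?B)"
    then obtain i j where ij: "i < ?n + 1" "j < ?n + 1" "i \<noteq> j" "col ?B i = col ?B j"
      using B by (auto simp: distinct_conv_nth)
    moreover have "?B *\<^sub>v unit_vec (?n + 1) k = col ?B k" if "k < ?n + 1" for k
      using B that by (intro eq_vecI) (auto simp: scalar_prod_right_unit)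
    \<comment> \<open>Two equal columns would put the difference of two unit vectors into the
      kernel.\<close>
    ultimately have "?B *\<^sub>v (unit_vec (?n + 1) i - unit_vec (?n + 1) j) = 0\<^sub>v (sat_dim \<phi>)"
      using B by (subst mult_minus_distrib_mat_vec[OF B]) auto
    from inj[OF _ this] have "unit_vec (?n + 1) i - unit_vec (?n + 1) j = (0\<^sub>v (?n + 1) :: real vec)"
      by simp
    from arg_cong[OF this, of "\<lambda>w. w $ i"] ij show False by simp
  qed
  moreover from this have
    "module.lin_indpt class_ring (module_vec TYPE(real) (sat_dim \<phi>)) (set (cols ?B))"
    using vec_space.lin_depE[OF B] inj by metis
  ultimately show ?thesis
    unfolding is_lattice_basis_def using B by auto
qed

section \<open>Satisfying assignments and short lattice vectors\<close>

lemma lit_val_eq_of_bool: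
  assumes "z 0 * z 0 = 1" "\<And>i. 1 \<le> i \<Longrightarrow> i \<le> n \<Longrightarrow> z 0 * z i = of_bool (v i)" "valid_lit n l"
  shows "z 0 * lit_val z l = of_bool (lit_true v l)"
proof -
  have "z 0 * z (nat \<bar>l\<bar>) = of_bool (v (nat \<bar>l\<bar>))"
    using assms(3) by (intro assms(2)) (auto simp: valid_lit_def)
  \<comment> \<open>As \<open>z 0\<close> is 1 or -1, the factor \<open>z 0\<close> treats a vector
    and its negative alike. A negative literal becomes \<open>1 - z 0 * z i\<close>, the negation of
    its variable.\<close>
  then show ?thesis
    using assms(1) by (auto simp: lit_val_def lit_true_def right_diff_distrib split: if_splits)
qed

lemma row_val_clause:
  assumes "j < length (clauses \<phi>)" "clauses \<phi> ! j = (a, b, c)"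
  shows "row_val \<phi> z (num_vars \<phi> + 1 + j) = lit_val z a + lit_val z b + lit_val z c - 2 * z 0"
  using assms by (simp add: row_val_def)

text \<open>A variable row takes the value 1 or -1, and a clause with one to three true literals a
  value between -1 and 1.\<close>

lemma row_val_satisfying:
  assumes "valid_cnf3 \<phi>" "i < sat_dim \<phi>"
    and sat: "\<forall>(a, b, c) \<in> set (clauses \<phi>). lit_true v a \<or> lit_true v b \<or> lit_true v c"
    and z: "z 0 = 1" "\<And>i. 1 \<le> i \<Longrightarrow> i \<le> num_vars \<phi> \<Longrightarrow> z i = of_bool (v i)"
  shows "\<bar>row_val \<phi> z i\<bar> \<le> 1"
proof (cases "i \<le> num_vars \<phi>")
  case True
  then show ?thesis using z by (cases "i = 0") (auto simp: row_val_def)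
next
  case False
  define j where "j = i - num_vars \<phi> - 1"
  have i: "i = num_vars \<phi> + 1 + j" and j: "j < length (clauses \<phi>)"
    using False assms(2) by (auto simp: j_def sat_dim_def)
  obtain a b c where abc: "clauses \<phi> ! j = (a, b, c)" using prod_cases3 by blast
  then have mem: "(a, b, c) \<in> set (clauses \<phi>)" using j nth_mem by metis
  then have "valid_lit (num_vars \<phi>) a" "valid_lit (num_vars \<phi>) b" "valid_lit (num_vars \<phi>) c"
    using assms(1) by (auto simp: valid_cnf3_def)
  then have "lit_val z l = of_bool (lit_true v l)" if "l \<in> {a, b, c}" for l
    using lit_val_eq_of_bool[of z "num_vars \<phi>" v l] that z by auto
  then show ?thesis
    using sat mem z(1) unfolding i row_val_clause[OF j abc] by auto
qed

lemma satisfiable_of_row_val: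
  assumes valid: "valid_cnf3 \<phi>"
    and int: "\<And>i. i \<le> num_vars \<phi> \<Longrightarrow> z i \<in> \<int>"
    and nonzero: "\<exists>i \<le> num_vars \<phi>. z i \<noteq> 0"
    and small: "\<And>i. i < sat_dim \<phi> \<Longrightarrow> \<bar>row_val \<phi> z i\<bar> < 2"
  shows "satisfiable \<phi>"
proof -
  let ?n = "num_vars \<phi>"
  have var: "\<bar>2 * z i - z 0\<bar> < 2" if "i \<le> ?n" for i
    using small[of i] that by (simp add: row_val_def sat_dim_def)
  obtain k where k: "z 0 = of_int k" using int[of 0] by (auto elim: Ints_cases)
  have zero: "k \<noteq> 0"
  proof
    assume "k = 0"
    have "z i = 0" if "i \<le> ?n" for i
    proof -
      obtain m where "z i = of_int m" using int[OF \<open>i \<le> ?n\<close>] by (auto elim: Ints_cases)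
      then show ?thesis using var[OF that] k \<open>k = 0\<close> by simp
    qed
    with nonzero show False by blast
  qed
  moreover have "\<bar>k\<bar> < 2" using var[of 0] k by simp
  ultimately have k1: "k = 1 \<or> k = - 1" by arith
  define v where "v i \<longleftrightarrow> z 0 * z i = 1" for i
  have z0: "z 0 * z 0 = 1" using k k1 by auto
  have v: "z 0 * z i = of_bool (v i)" if "i \<le> ?n" for i
  proof -
    obtain m where m: "z i = of_int m" using int[OF \<open>i \<le> ?n\<close>] by (auto elim: Ints_cases)
    have "\<bar>real_of_int (2 * m - k)\<bar> < 2" using var[OF that] k m by simp
    then have "\<bar>2 * m - k\<bar> < 2" by linarith
    \<comment> \<open>For \<open>k = 1\<close> this leaves \<open>m\<close> in {0, 1}, for
      \<open>k = - 1\<close> it leaves \<open>m\<close> in {0, -1}.\<close>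
    with k1 have "k * m = 0 \<or> k * m = 1" by auto
    then have "z 0 * z i = 0 \<or> z 0 * z i = 1"
      unfolding k m by (metis of_int_0 of_int_1 of_int_mult)
    then show ?thesis by (auto simp: v_def)
  qed
  have "lit_true v a \<or> lit_true v b \<or> lit_true v c" if mem: "(a, b, c) \<in> set (clauses \<phi>)" for a b c
  proof (rule ccontr)
    assume not: "\<not> ?thesis"
    obtain j where j: "j < length (clauses \<phi>)" "clauses \<phi> ! j = (a, b, c)"
      using mem by (auto simp: in_set_conv_nth)
    have "valid_lit ?n a" "valid_lit ?n b" "valid_lit ?n c"
      using mem valid by (auto simp: valid_cnf3_def)
    then have "z 0 * lit_val z l = 0" if "l \<in> {a, b, c}" for l
      using lit_val_eq_of_bool[of z ?n v l] z0 v that not by auto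
    moreover have "z 0 \<noteq> 0" using z0 by auto
    \<comment> \<open>With all three literals false only the shift remains, and its absolute value
      is 2.\<close>
    ultimately have "row_val \<phi> z (?n + 1 + j) = - 2 * z 0"
      unfolding row_val_clause[OF j] by auto
    moreover have "\<bar>row_val \<phi> z (?n + 1 + j)\<bar> < 2" using j by (intro small) (simp add: sat_dim_def)
    ultimately show False using k k1 by auto
  qed
  then show ?thesis unfolding satisfiable_def by blast
qed

lemma lattice_of_sat_instance:
  assumes "valid_cnf3 \<phi>"
  shows "lattice_of (svp_real_basis (sat_instance c \<phi>)) =
    {vec (sat_dim \<phi>) (row_val \<phi> (($) y)) | y. y \<in> carrier_vec (num_vars \<phi> + 1) \<and>
      (\<forall>i < num_vars \<phi> + 1. y $ i \<in> \<int>)}"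
proof -
  have "dim_col (map_mat real_of_rat (sat_basis \<phi>)) = num_vars \<phi> + 1" by (simp add: sat_basis_def)
  then show ?thesis
    unfolding lattice_of_def svp_real_basis_def sat_instance_def
    using sat_basis_mult_vec[OF assms] by (auto simp del: One_nat_def) metis+
qed

lemma row_val_Ints:
  assumes "valid_cnf3 \<phi>" "i < sat_dim \<phi>" "\<And>i. i \<le> num_vars \<phi> \<Longrightarrow> z i \<in> \<int>"
  shows "row_val \<phi> z i \<in> \<int>"
  unfolding sum_sat_entry[OF assms(1,2), of z, symmetric]
  using assms(3) by (intro Ints_sum Ints_mult) auto

section \<open>The dimension and the norm parameter\<close>

lemma length_clauses_le:
  assumes "valid_cnf3 \<phi>"
  shows "length (clauses \<phi>) \<le> (2 * num_vars \<phi> + 1) ^ 3"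
proof -
  define S where "S = {- int (num_vars \<phi>)..int (num_vars \<phi>)}"
  \<comment> \<open>Distinct clauses are distinct triples over the interval, so counting triples
    bounds the length of the list.\<close>
  have "set (clauses \<phi>) \<subseteq> S \<times> S \<times> S"
    using assms by (fastforce simp: valid_cnf3_def valid_lit_def S_def)
  then have "card (set (clauses \<phi>)) \<le> card (S \<times> S \<times> S)"
    by (intro card_mono) (auto simp: S_def)
  also have "card S = 2 * num_vars \<phi> + 1" by (simp add: S_def)
  then have "card (S \<times> S \<times> S) = (2 * num_vars \<phi> + 1) ^ 3"
    by (simp only: card_cartesian_product power3_eq_cube mult.assoc)
  finally show ?thesis
    using assms by (simp add: valid_cnf3_def distinct_card)
qed

lemma sat_dim_le:
  assumes "valid_cnf3 \<phi>"
  shows "sat_dim \<phi> \<le> 8 * (num_vars \<phi> + 1) ^ 3"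
proof -
  have "sat_dim \<phi> \<le> num_vars \<phi> + 1 + (2 * num_vars \<phi> + 1) ^ 3"
    using length_clauses_le[OF assms] by (simp add: sat_dim_def)
  also have "\<dots> \<le> 8 * (num_vars \<phi> + 1) ^ 3"
    by (simp add: power3_eq_cube algebra_simps)
  finally show ?thesis .
qed

text \<open>By Bernoulli's inequality \<open>(1 + 1 / c) ^ c\<close> is at least 2, so the chosen
  exponent yields at least the power of two that bounds the dimension.\<close>

lemma sat_dim_le_powr:
  assumes "valid_cnf3 \<phi>" "1 \<le> c"
  shows "real (sat_dim \<phi>) \<le> (1 + 1 / real c) powr real (sat_param c (num_vars \<phi>))"
proof -
  let ?N = "ceillog2 (num_vars \<phi> + 1)"
  have "sat_dim \<phi> \<le> 8 * (num_vars \<phi> + 1) ^ 3" by (rule sat_dim_le[OF assms(1)])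
  also have "\<dots> \<le> 8 * (2 ^ ?N) ^ 3"
    using le_two_power_ceillog2 by (intro mult_left_mono power_mono) auto
  also have "\<dots> = 2 ^ (3 + 3 * ?N)"
    by (simp add: power_add power_mult[symmetric] mult.commute)
  finally have "real (sat_dim \<phi>) \<le> 2 ^ (3 + 3 * ?N)"
    by (metis of_nat_le_iff of_nat_numeral of_nat_power)
  also have "(2 :: real) \<le> (1 + 1 / real c) ^ c"
    using Bernoulli_inequality[of "1 / real c" c] assms(2) order_trans[of "- 1" 0 "1 / real c"]
    by simp
  then have "(2 :: real) ^ (3 + 3 * ?N) \<le> ((1 + 1 / real c) ^ c) ^ (3 + 3 * ?N)"
    by (intro power_mono) auto
  also have "\<dots> = (1 + 1 / real c) powr real (sat_param c (num_vars \<phi>))"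
    by (subst powr_realpow) (auto simp: sat_param_def power_mult intro: add_pos_nonneg)
  finally show ?thesis .
qed

lemma valid_svp_sat_instance:
  assumes "valid_cnf3 \<phi>" "1 \<le> c"
  shows "valid_svp (sat_instance c \<phi>)"
  using assms is_lattice_basis_sat_basis[OF assms(1)]
  by (auto simp: valid_svp_def svp_rank_def svp_real_basis_def sat_instance_def sat_param_def
      sat_basis_def intro: add_pos_nonneg)

text \<open>A satisfying assignment gives a vector with entries of absolute value at most 1. Without
  one, even the shortest vector has an entry of absolute value at least 2.\<close>

lemma svp_lambda1_sat_instance:
  assumes valid: "valid_cnf3 \<phi>" and c: "1 \<le> c"
  shows "satisfiable \<phi> \<Longrightarrow> svp_lambda1 (sat_instance c \<phi>) \<le> 1 + 1 / real c"
    and "\<not> satisfiable \<phi> \<Longrightarrow> 2 \<le> svp_lambda1 (sat_instance c \<phi>)"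
proof -
  let ?n = "num_vars \<phi>"
  define p where "p = sat_param c ?n"
  define L where "L = lattice_of (svp_real_basis (sat_instance c \<phi>))"
  have p: "1 \<le> p" using c by (simp add: p_def sat_param_def)
  have lambda1: "svp_lambda1 (sat_instance c \<phi>) = lambda1 (real p) L"
    by (simp add: svp_lambda1_def L_def p_def sat_instance_def)
  have L: "L = {vec (sat_dim \<phi>) (row_val \<phi> (($) y)) | y.
      y \<in> carrier_vec (?n + 1) \<and> (\<forall>i < ?n + 1. y $ i \<in> \<int>)}"
    unfolding L_def by (rule lattice_of_sat_instance[OF valid])
  have memI: "vec (sat_dim \<phi>) (row_val \<phi> (($) y)) \<in> L"
    if "y \<in> carrier_vec (?n + 1)" "\<And>i. i < ?n + 1 \<Longrightarrow> y $ i \<in> \<int>" for y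
    unfolding L using that by blast
  \<comment> \<open>The lattice vector of an assignment. Its entry 0 is 1 for every
    \<open>v\<close>, which also shows that nonzero lattice vectors exist.\<close>
  define w where "w v = vec (sat_dim \<phi>) (row_val \<phi>
      (($) (vec (?n + 1) (\<lambda>i. if i = 0 then 1 else of_bool (v i)))))" for v :: "nat \<Rightarrow> bool"
  have w: "w v \<in> L" "w v \<noteq> 0\<^sub>v (dim_vec (w v))" for v
  proof -
    show "w v \<in> L" unfolding w_def by (intro memI) auto
    have "w v $ 0 = 1" "0 < dim_vec (w v)" by (simp_all add: w_def row_val_def sat_dim_def)
    then show "w v \<noteq> 0\<^sub>v (dim_vec (w v))" by (metis index_zero_vec(1) zero_neq_one)
  qed
  have int: "u $ i \<in> \<int>" if "u \<in> L" "i < dim_vec u" for u i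
    using that unfolding L by (auto intro!: row_val_Ints[OF valid])
  obtain u where u: "u \<in> L" "u \<noteq> 0\<^sub>v (dim_vec u)" "lambda1 (real p) L = lp_norm (real p) u"
    and le: "\<And>u. u \<in> L \<Longrightarrow> u \<noteq> 0\<^sub>v (dim_vec u) \<Longrightarrow> lambda1 (real p) L \<le> lp_norm (real p) u"
    by (rule lambda1_attained[OF p int]) (use w in auto)
  {
    assume "satisfiable \<phi>"
    then obtain v where
      sat: "\<forall>(a, b, c) \<in> set (clauses \<phi>). lit_true v a \<or> lit_true v b \<or> lit_true v c"
      unfolding satisfiable_def by blast
    have "lp_norm (real p) (w v) \<le> 1 + 1 / real c"
    proof (rule lp_norm_le)
      fix i assume "i < dim_vec (w v)"
      then show "\<bar>w v $ i\<bar> \<le> 1"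
        using row_val_satisfying[OF valid _ sat] by (auto simp: w_def)
    qed (use p sat_dim_le_powr[OF valid c] in \<open>auto simp: w_def p_def\<close>)
    with le[OF w] show "svp_lambda1 (sat_instance c \<phi>) \<le> 1 + 1 / real c"
      unfolding lambda1 by (meson order_trans)
  }
  {
    assume unsat: "\<not> satisfiable \<phi>"
    obtain y where y: "y \<in> carrier_vec (?n + 1)" "\<And>i. i < ?n + 1 \<Longrightarrow> y $ i \<in> \<int>"
      and uy: "u = vec (sat_dim \<phi>) (row_val \<phi> (($) y))"
      using u(1) unfolding L by blast
    have "\<exists>i \<le> ?n. y $ i \<noteq> 0"
    proof (rule ccontr)
      assume "\<not> ?thesis"
      with y(1) have "y = 0\<^sub>v (?n + 1)" by (intro eq_vecI) auto
      then have "u = 0\<^sub>v (sat_dim \<phi>)"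
        unfolding uy sat_basis_mult_vec[OF valid y(1), symmetric]
        by (auto simp: sat_basis_def)
      with u(2) show False by simp
    qed
    then obtain i where "i < sat_dim \<phi>" "2 \<le> \<bar>row_val \<phi> (($) y) i\<bar>"
      using satisfiable_of_row_val[OF valid, of "($) y"] y(2) unsat by force
    then show "2 \<le> svp_lambda1 (sat_instance c \<phi>)"
      unfolding lambda1 u(3) using p by (intro lp_norm_ge[of _ i]) (auto simp: uy)
  }
qed

section \<open>Encodings\<close>

lemma nth_concat_map_const:
  assumes "\<And>x. x \<in> set xs \<Longrightarrow> length (f x) = d" "j < length xs" "k < d"
  shows "concat (map f xs) ! (d * j + k) = f (xs ! j) ! k"
  using assms
proof (induction xs arbitrary: j)
  case (Cons x xs)
  then show ?case by (cases j) (auto simp: nth_append)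
qed simp

lemma length_concat_map_const:
  assumes "\<And>x. x \<in> set xs \<Longrightarrow> length (f x) = d"
  shows "length (concat (map f xs)) = d * length xs"
  using assms by (induction xs) auto

lemma enc_rat_of_int: "enc_rat (of_int z) = [z, 1]"
  by (simp add: enc_rat_def)

text \<open>Consecutive integers are coprime, so \<open>(c + 1) / c\<close> is in lowest
  terms.\<close>

lemma enc_rat_threshold:
  assumes "1 \<le> c"
  shows "enc_rat (1 + 1 / of_nat c) = [int c + 1, int c]"
proof -
  have "1 + 1 / of_nat c = Rat.Fract (int c + 1) (int c)"
    using assms by (simp add: Fract_of_int_quotient divide_simps)
  moreover have "coprime (int c + 1) (int c)"
    by (simp add: coprime_commute)
  ultimately show ?thesis
    using assms by (simp add: enc_rat_def quotient_of_Fract Rat.normalize_stable)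
qed

lemma enc_svp_sat_instance:
  assumes "1 \<le> c"
  shows "enc_svp (sat_instance c \<phi>) =
    [int (sat_param c (num_vars \<phi>)), int (num_vars \<phi> + 1), int (sat_dim \<phi>), int c + 1, int c] @
    concat (map (\<lambda>v. concat (map (\<lambda>i. [sat_entry \<phi> i v, 1]) [0..<sat_dim \<phi>])) [0..<num_vars \<phi> + 1])"
proof -
  have "list_of_vec (col (sat_basis \<phi>) v) = map (\<lambda>i. of_int (sat_entry \<phi> i v)) [0..<sat_dim \<phi>]"
    if "v < num_vars \<phi> + 1" for v
    using that by (intro nth_equalityI) (auto simp: sat_basis_def list_of_vec_index)
  then have "map (\<lambda>v. concat (map enc_rat (list_of_vec (col (sat_basis \<phi>) v)))) [0..<num_vars \<phi> + 1] =
      map (\<lambda>v. concat (map (\<lambda>i. [sat_entry \<phi> i v, 1]) [0..<sat_dim \<phi>])) [0..<num_vars \<phi> + 1]"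
    by (intro map_cong refl) (simp add: enc_rat_of_int comp_def del: upt_Suc)
  moreover have "cols (sat_basis \<phi>) = map (col (sat_basis \<phi>)) [0..<num_vars \<phi> + 1]"
    by (simp add: cols_def sat_basis_def)
  moreover have "dim_col (sat_basis \<phi>) = num_vars \<phi> + 1" "dim_row (sat_basis \<phi>) = sat_dim \<phi>"
    by (simp_all add: sat_basis_def)
  ultimately show ?thesis
    unfolding enc_svp_def sat_instance_def
    by (simp add: enc_rat_threshold[OF assms] comp_def del: upt_Suc map_eq_conv)
qed

lemma length_enc_svp_sat_instance:
  assumes "1 \<le> c"
  shows "length (enc_svp (sat_instance c \<phi>)) = 5 + 2 * ((num_vars \<phi> + 1) * sat_dim \<phi>)"
  unfolding enc_svp_sat_instance[OF assms] length_append
  by (subst length_concat_map_const[where d = "2 * sat_dim \<phi>"])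
    (simp_all add: length_concat_map_const[where d = 2])

text \<open>Cells are numbered column by column. After five header numbers, cell \<open>q\<close>
  takes two positions, for its numerator and its denominator 1.\<close>

lemma enc_svp_sat_instance_nth:
  assumes "1 \<le> c" "q < (num_vars \<phi> + 1) * sat_dim \<phi>"
  shows "enc_svp (sat_instance c \<phi>) ! (5 + 2 * q) = sat_entry \<phi> (q mod sat_dim \<phi>) (q div sat_dim \<phi>)"
    and "enc_svp (sat_instance c \<phi>) ! (6 + 2 * q) = 1"
proof -
  define D v i where "D = sat_dim \<phi>" and "v = q div D" and "i = q mod D"
  define col where "col v = concat (map (\<lambda>i. [sat_entry \<phi> i v, 1]) [0..<D])" for v
  have "0 < D" by (simp add: D_def sat_dim_def)
  then have i: "i < D" and v: "v < num_vars \<phi> + 1" and q: "q = D * v + i"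
    using assms(2) by (auto simp: i_def v_def D_def less_mult_imp_div_less)
  have nth: "enc_svp (sat_instance c \<phi>) ! (5 + 2 * q + k) = [sat_entry \<phi> i v, 1] ! k" if "k < 2" for k
  proof -
    have "enc_svp (sat_instance c \<phi>) ! (5 + 2 * q + k) =
        concat (map col [0..<num_vars \<phi> + 1]) ! (2 * q + k)"
      unfolding enc_svp_sat_instance[OF assms(1)] col_def D_def
      by (subst nth_append_right) (simp_all del: upt_Suc)
    \<comment> \<open>Column \<open>v\<close> is a block of \<open>2 * D\<close> numbers, within
      which row \<open>i\<close> starts at \<open>2 * i\<close>.\<close>
    also have "2 * q + k = (2 * D) * v + (2 * i + k)"
      unfolding q by (simp add: algebra_simps)
    also have "concat (map col [0..<num_vars \<phi> + 1]) ! \<dots> = col ([0..<num_vars \<phi> + 1] ! v) ! (2 * i + k)"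
      using v i that
      by (intro nth_concat_map_const) (simp_all add: col_def length_concat_map_const[where d = 2])
    also have "\<dots> = col v ! (2 * i + k)" using v by (simp del: upt_Suc)
    also have "\<dots> = [sat_entry \<phi> ([0..<D] ! i) v, 1] ! k"
      unfolding col_def using i that by (intro nth_concat_map_const) auto
    finally show ?thesis using i by simp
  qed
  show "enc_svp (sat_instance c \<phi>) ! (5 + 2 * q) = sat_entry \<phi> (q mod sat_dim \<phi>) (q div sat_dim \<phi>)"
    using nth[of 0] by (simp add: i_def v_def D_def)
  show "enc_svp (sat_instance c \<phi>) ! (6 + 2 * q) = 1"
    using nth[of 1] by (simp add: add.commute)
qed

section \<open>The encoded formula as the input array\<close>

definition sat_tape :: "cnf3 \<Rightarrow> int \<Rightarrow> int" where
  "sat_tape \<phi> = arrs (input_state (enc_cnf3 \<phi>)) 0"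

lemma length_enc_cnf3: "length (enc_cnf3 \<phi>) = 2 + 3 * length (clauses \<phi>)"
  unfolding enc_cnf3_def length_append
  by (subst length_concat_map_const[where d = 3]) auto

lemma sat_tape_header: "sat_tape \<phi> 0 = int (num_vars \<phi>)" "sat_tape \<phi> 1 = int (length (clauses \<phi>))"
  by (simp_all add: sat_tape_def input_state_def enc_cnf3_def)

lemma sat_tape_clause:
  assumes "j < length (clauses \<phi>)" "clauses \<phi> ! j = (a, b, c)" "k < 3"
  shows "sat_tape \<phi> (int (2 + 3 * j + k)) = [a, b, c] ! k"
proof -
  have "2 + 3 * j + k < length (enc_cnf3 \<phi>)" using assms unfolding length_enc_cnf3 by simp
  moreover have "sat_tape \<phi> (int x) = enc_cnf3 \<phi> ! x" if "x < length (enc_cnf3 \<phi>)" for x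
    using that by (simp add: sat_tape_def input_state_def)
  ultimately have "sat_tape \<phi> (int (2 + 3 * j + k)) = enc_cnf3 \<phi> ! (2 + 3 * j + k)"
    by blast
  also have "\<dots> = concat (map (\<lambda>(a, b, c). [a, b, c]) (clauses \<phi>)) ! (3 * j + k)"
    by (simp add: enc_cnf3_def)
  also have "\<dots> = (case clauses \<phi> ! j of (a, b, c) \<Rightarrow> [a, b, c]) ! k"
    using assms by (intro nth_concat_map_const) auto
  finally show ?thesis using assms(2) by simp
qed

section \<open>The reduction program\<close>

definition lit_coeff_expr :: "expr \<Rightarrow> expr \<Rightarrow> expr" where
  "lit_coeff_expr l v =
     Bin OpAdd (Bin OpSub (Bin OpEq l v) (Bin OpEq l (Bin OpSub (Lit 0) v)))
       (Bin OpMul (Bin OpEq v (Lit 0)) (Bin OpLess l (Lit 0)))"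

lemma value_of_lit_coeff_expr:
  "value_of s (lit_coeff_expr l v) = lit_coeff (value_of s l) (value_of s v)"
  by (simp add: lit_coeff_expr_def lit_coeff_def)

definition row_expr :: expr where "row_expr = Bin OpMod (Reg 5) (Reg 2)"
definition col_expr :: expr where "col_expr = Bin OpDiv (Reg 5) (Reg 2)"

text \<open>The rows of the variables read the tape at negative positions, which hold \<open>0\<close>.\<close>

definition lit_expr :: "int \<Rightarrow> expr" where
  "lit_expr k = Arr 0 (Bin OpAdd (Bin OpMul (Lit 3) (Bin OpSub row_expr (Reg 1))) (Lit (k - 1)))"

text \<open>Comparisons evaluate to 0 or 1 and serve as factors that select the variable row or the
  clause row without branching.\<close>

definition entry_expr :: expr where
  "entry_expr =
     Bin OpAdd
       (Bin OpMul (Bin OpLess row_expr (Bin OpAdd (Reg 1) (Lit 1)))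
         (Bin OpSub (Bin OpMul (Lit 2) (Bin OpEq col_expr row_expr)) (Bin OpEq col_expr (Lit 0))))
       (Bin OpMul (Bin OpLess (Reg 1) row_expr)
         (Bin OpSub
           (Bin OpAdd (Bin OpAdd (lit_coeff_expr (lit_expr 0) col_expr) (lit_coeff_expr (lit_expr 1) col_expr))
             (lit_coeff_expr (lit_expr 2) col_expr))
           (Bin OpMul (Lit 2) (Bin OpEq col_expr (Lit 0)))))"

lemma simple_entry_expr: "simple_expr entry_expr"
  by (simp add: entry_expr_def lit_coeff_expr_def lit_expr_def row_expr_def col_expr_def)

lemma value_of_entry_expr:
  assumes "regs s 1 = int (num_vars \<phi>)" "regs s 2 = int (sat_dim \<phi>)" "regs s 5 = int q"
    and tape: "arrs s 0 = sat_tape \<phi>"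
  shows "value_of s entry_expr = sat_entry \<phi> (q mod sat_dim \<phi>) (q div sat_dim \<phi>)"
proof -
  define n D i v where "n = num_vars \<phi>" and "D = sat_dim \<phi>" and "i = q mod D" and "v = q div D"
  have i: "value_of s row_expr = int i" and v: "value_of s col_expr = int v"
    using assms by (simp_all add: row_expr_def col_expr_def i_def v_def D_def zdiv_int zmod_int)
  have iD: "i < D" by (simp add: i_def D_def sat_dim_def)
  have reg1: "value_of s (Reg 1) = int n" using assms by (simp add: n_def)
  show ?thesis
  proof (cases "i \<le> n")
    case True
    \<comment> \<open>The factor of the clause part is 0, so the literals read from the tape have no
      effect.\<close>
    then have "value_of s entry_expr = 2 * of_bool (v = i) - of_bool (v = 0)"
      by (simp add: entry_expr_def i v reg1[simplified])
    then show ?thesis using True by (simp add: sat_entry_def i_def v_def n_def D_def)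
  next
    case False
    define j where "j = i - n - 1"
    have j: "j < length (clauses \<phi>)" using False iD by (simp add: j_def D_def sat_dim_def n_def)
    have ij: "i = n + 1 + j" using False by (simp add: j_def)
    obtain a b c where abc: "clauses \<phi> ! j = (a, b, c)" using prod_cases3 by blast
    have "value_of s (lit_expr (int k)) = [a, b, c] ! k" if "k < 3" for k
    proof -
      have "value_of s (lit_expr (int k)) = sat_tape \<phi> (int (2 + 3 * j + k))"
        unfolding lit_expr_def value_of.simps(3,4) i reg1 tape
        \<comment> \<open>With \<open>i = n + 1 + j\<close>, the address
          \<open>3 * (i - n) + k - 1\<close> equals \<open>2 + 3 * j + k\<close>, behind the two
          header numbers and \<open>j\<close> earlier clauses.\<close>
        by (rule arg_cong[of _ _ "sat_tape \<phi>"]) (simp add: ij)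
      then show ?thesis using sat_tape_clause[OF j abc that] by simp
    qed
    from this[of 0] this[of 1] this[of 2]
    have "value_of s (lit_expr 0) = a" "value_of s (lit_expr 1) = b" "value_of s (lit_expr 2) = c"
      by simp_all
    then have "value_of s entry_expr = clause_coeff (a, b, c) (int v)"
      using False
      by (simp add: entry_expr_def i v reg1[simplified] value_of_lit_coeff_expr clause_coeff_def)
    then show ?thesis
      using False abc by (simp add: sat_entry_def i_def v_def n_def D_def j_def)
  qed
qed

section \<open>The program and the states it passes through\<close>

definition log_loop :: prog where
  "log_loop = While (Bin OpLess (Reg 4) (Bin OpAdd (Reg 1) (Lit 1)))
     (Seq (Assign 4 (Bin OpMul (Reg 4) (Lit 2))) (Assign 3 (Bin OpAdd (Reg 3) (Lit 1))))"

text \<open>The output goes to array 1, which the renamed solver takes for its input array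
  0.\<close>

definition header_prog :: "nat \<Rightarrow> prog" where
  "header_prog c =
     Seq (Store 1 (Lit 0) (Bin OpMul (Lit (int c)) (Bin OpAdd (Lit 3) (Bin OpMul (Lit 3) (Reg 3)))))
    (Seq (Store 1 (Lit 1) (Bin OpAdd (Reg 1) (Lit 1)))
    (Seq (Store 1 (Lit 2) (Reg 2))
    (Seq (Store 1 (Lit 3) (Lit (int c + 1)))
         (Store 1 (Lit 4) (Lit (int c))))))"

definition matrix_loop :: prog where
  "matrix_loop = While (Bin OpLess (Reg 5) (Bin OpMul (Bin OpAdd (Reg 1) (Lit 1)) (Reg 2)))
     (Seq (Store 1 (Bin OpAdd (Lit 5) (Bin OpMul (Lit 2) (Reg 5))) entry_expr)
     (Seq (Store 1 (Bin OpAdd (Lit 6) (Bin OpMul (Lit 2) (Reg 5))) (Lit 1))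
          (Assign 5 (Bin OpAdd (Reg 5) (Lit 1)))))"

definition reduction_prog :: "nat \<Rightarrow> prog" where
  "reduction_prog c =
     Seq (Assign 1 (Arr 0 (Lit 0)))
    (Seq (Assign 2 (Bin OpAdd (Bin OpAdd (Reg 1) (Lit 1)) (Arr 0 (Lit 1))))
    (Seq (Assign 4 (Lit 1))
    (Seq log_loop
    (Seq (header_prog c) matrix_loop))))"

text \<open>Registers 1 to 5 hold the number of variables, the dimension, the logarithm that is being
  computed, the corresponding power of two, and the number of matrix entries written so far.\<close>

definition reduction_state ::
    "cnf3 \<Rightarrow> int \<Rightarrow> int \<Rightarrow> int \<Rightarrow> int \<Rightarrow> int \<Rightarrow> (int \<Rightarrow> int) \<Rightarrow> state" where
  "reduction_state \<phi> n d a b q f =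
     \<lparr>regs = (\<lambda>_. 0)(1 := n, 2 := d, 3 := a, 4 := b, 5 := q),
      arrs = (\<lambda>_ _. 0)(0 := sat_tape \<phi>, 1 := f)\<rparr>"

lemma reduction_state_simps [simp]:
  "regs (reduction_state \<phi> n d a b q f) (Suc 0) = n"
  "regs (reduction_state \<phi> n d a b q f) 2 = d"
  "regs (reduction_state \<phi> n d a b q f) 3 = a"
  "regs (reduction_state \<phi> n d a b q f) 4 = b"
  "regs (reduction_state \<phi> n d a b q f) 5 = q"
  "arrs (reduction_state \<phi> n d a b q f) 0 = sat_tape \<phi>"
  "arrs (reduction_state \<phi> n d a b q f) (Suc 0) = f"
  by (simp_all add: reduction_state_def)

lemma reduction_state_update:
  fixes \<phi> n d a b q f
  defines "s \<equiv> reduction_state \<phi> n d a b q f"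
  shows "s\<lparr>regs := (regs s)(1 := x)\<rparr> = reduction_state \<phi> x d a b q f"
    "s\<lparr>regs := (regs s)(2 := x)\<rparr> = reduction_state \<phi> n x a b q f"
    "s\<lparr>regs := (regs s)(3 := x)\<rparr> = reduction_state \<phi> n d x b q f"
    "s\<lparr>regs := (regs s)(4 := x)\<rparr> = reduction_state \<phi> n d a x q f"
    "s\<lparr>regs := (regs s)(5 := x)\<rparr> = reduction_state \<phi> n d a b x f"
    "s\<lparr>arrs := (arrs s)(1 := (arrs s 1)(i := x))\<rparr> = reduction_state \<phi> n d a b q (f(i := x))"
  by (auto simp: s_def reduction_state_def fun_eq_iff)

lemma reduction_state_input: "input_state (enc_cnf3 \<phi>) = reduction_state \<phi> 0 0 0 0 0 (\<lambda>_. 0)"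
  by (auto simp: input_state_def reduction_state_def sat_tape_def fun_eq_iff)

text \<open>One bound for all numbers, loop counts and lengths that occur. The fourth power comes
  from the number of matrix cells, \<open>3 * c\<close> from the norm parameter, and 21 = 5 + 2 * 8
  from the length of the output.\<close>

definition size_bound :: "nat \<Rightarrow> nat \<Rightarrow> nat" where
  "size_bound c n = (3 * c + 21) * (n + 1) ^ 4"

text \<open>The invariant of the output array: the first \<open>k\<close> numbers are written, all
  other positions still hold 0.\<close>

definition prefix_tape :: "int list \<Rightarrow> nat \<Rightarrow> int \<Rightarrow> int" where
  "prefix_tape xs k i = (if 0 \<le> i \<and> i < int k then xs ! nat i else 0)"

lemma prefix_tape_Suc: "(prefix_tape xs k)(int k := xs ! k) = prefix_tape xs (Suc k)"
  by (auto simp: prefix_tape_def fun_eq_iff)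

lemma abs_lit_coeff_le: "\<bar>lit_coeff l v\<bar> \<le> 2"
  by (simp add: lit_coeff_def)

lemma abs_sat_entry_le: "\<bar>sat_entry \<phi> i v\<bar> \<le> 8"
proof (cases "i \<le> num_vars \<phi>")
  case False
  obtain a b c where "clauses \<phi> ! (i - num_vars \<phi> - 1) = (a, b, c)" using prod_cases3 by blast
  then show ?thesis
    using False abs_lit_coeff_le[of a v] abs_lit_coeff_le[of b v] abs_lit_coeff_le[of c v]
    unfolding sat_entry_def clause_coeff_def by (auto simp del: of_nat_eq_0_iff split: if_splits)
qed (simp add: sat_entry_def)

lemma ceillog2_Suc_le: "ceillog2 (n + 1) \<le> n"
  using ceillog2_le_iff[of "n + 1" n] less_exp[of n] by simp

section \<open>Correctness and running time of the reduction\<close>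

locale sat_reduction =
  fixes \<phi> :: cnf3 and c L :: nat
  assumes valid: "valid_cnf3 \<phi>" and c: "1 \<le> c" and L: "0 < L"
begin

definition "n = num_vars \<phi>"
definition "D = sat_dim \<phi>"
definition "N = ceillog2 (n + 1)"
definition "B = size_bound c n"
definition "xs = enc_svp (sat_instance c \<phi>)"

lemma le_B: "x \<le> a * (n + 1) ^ k \<Longrightarrow> a \<le> 3 * c + 21 \<Longrightarrow> k \<le> 4 \<Longrightarrow> x \<le> B"
  unfolding B_def size_bound_def
  by (erule order_trans) (intro mult_mono power_increasing; simp)

lemma D_le: "D \<le> 8 * (n + 1) ^ 3"
  unfolding D_def n_def by (rule sat_dim_le[OF valid])

lemma cells_le: "(n + 1) * D \<le> 8 * (n + 1) ^ 4"
proof -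
  have "(n + 1) * D \<le> (n + 1) * (8 * (n + 1) ^ 3)" by (intro mult_left_mono D_le) simp
  also have "\<dots> = 8 * (n + 1) ^ 4" by (simp only: power4_eq_xxxx power3_eq_cube mult_ac)
  finally show ?thesis .
qed

lemma length_xs: "length xs = 5 + 2 * ((n + 1) * D)"
  unfolding xs_def n_def D_def by (rule length_enc_svp_sat_instance[OF c])

lemma B_bounds:
  shows "2 \<le> B" "n + 1 \<le> B" "D \<le> B" "N \<le> B" "2 ^ N \<le> B" "(n + 1) * D \<le> B"
    "length xs \<le> B" "c + 1 \<le> B" "8 \<le> B" "sat_param c n \<le> B"
proof -
  have N: "N \<le> n" unfolding N_def by (rule ceillog2_Suc_le)
  have const: "a \<le> B" if "a \<le> 3 * c + 21" for a
    using le_B[of a a 0] that by simp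
  show "2 \<le> B" "c + 1 \<le> B" "8 \<le> B" by (rule const; simp)+
  show "n + 1 \<le> B" by (rule le_B[of _ 1 1]) simp_all
  show "N \<le> B" by (rule le_B[of _ 1 1]) (use N in simp_all)
  have "2 ^ N \<le> 2 * (n + 1)"
    using two_power_ceillog2_gt[of "n + 1"] by (simp add: N_def)
  then show "2 ^ N \<le> B" by (intro le_B[of _ 2 1]) simp_all
  show "D \<le> B" using D_le by (intro le_B[of _ 8 3]) simp_all
  show "(n + 1) * D \<le> B" using cells_le by (intro le_B[of _ 8 4]) simp_all
  have "1 \<le> (n + 1) ^ 4" by simp
  then have "length xs \<le> 21 * (n + 1) ^ 4" using cells_le unfolding length_xs by linarith
  then show "length xs \<le> B" by (intro le_B[of _ 21 4]) simp_all
  have "sat_param c n \<le> c * (3 + 3 * n)" using N by (simp add: sat_param_def N_def)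
  then show "sat_param c n \<le> B" by (intro le_B[of _ "3 * c" 1]) (simp_all add: algebra_simps)
qed

lemma abs_set_xs_le: "x \<in> set xs \<Longrightarrow> \<bar>x\<bar> \<le> int B"
  using B_bounds order_trans[OF abs_sat_entry_le, of "int B" \<phi>]
  unfolding xs_def enc_svp_sat_instance[OF c] n_def[symmetric] D_def[symmetric]
  by (auto simp del: upt_Suc)

lemma abs_prefix_tape_le: "k \<le> length xs \<Longrightarrow> \<bar>prefix_tape xs k i\<bar> \<le> int B"
  using abs_set_xs_le by (auto simp: prefix_tape_def intro!: abs_set_xs_le nth_mem)

lemma abs_sat_tape_le: "\<bar>sat_tape \<phi> i\<bar> \<le> int B"
proof -
  have "\<bar>x\<bar> \<le> int B" if "x \<in> set (enc_cnf3 \<phi>)" for x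
    using that valid B_bounds(2,3)
    by (fastforce simp: enc_cnf3_def valid_cnf3_def valid_lit_def D_def sat_dim_def n_def)
  then show ?thesis by (auto simp: sat_tape_def input_state_def intro!: nth_mem)
qed

lemma bounded_reduction_state:
  assumes "\<bar>n'\<bar> \<le> int B" "\<bar>d\<bar> \<le> int B" "\<bar>a\<bar> \<le> int B" "\<bar>b\<bar> \<le> int B" "\<bar>q\<bar> \<le> int B"
    "\<And>i. \<bar>f i\<bar> \<le> int B"
  shows "bounded_state B (reduction_state \<phi> n' d a b q f)"
  using assms abs_sat_tape_le by (simp add: bounded_state_def reduction_state_def)

lemma runs_update:
  fixes n' d a b q f
  defines "s \<equiv> reduction_state \<phi> n' d a b q f"
  assumes "bounded_state B s" "simple_expr e" "value_of s e = x"
  shows "runs L B (Assign 1 e) s (reduction_state \<phi> x d a b q f)"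
    and "runs L B (Assign 2 e) s (reduction_state \<phi> n' x a b q f)"
    and "runs L B (Assign 3 e) s (reduction_state \<phi> n' d x b q f)"
    and "runs L B (Assign 4 e) s (reduction_state \<phi> n' d a x q f)"
    and "runs L B (Assign 5 e) s (reduction_state \<phi> n' d a b x f)"
    and "simple_expr e' \<Longrightarrow> value_of s e' = i \<Longrightarrow>
      runs L B (Store 1 e' e) s (reduction_state \<phi> n' d a b q (f(i := x)))"
  using runs_Assign[OF L B_bounds(1) assms(2-4)] runs_Store[OF L B_bounds(1) assms(2) _ assms(3) _ assms(4)]
  unfolding s_def by (metis reduction_state_update)+

lemma bounds_int: "int n \<le> int B" "int D \<le> int B" "int N \<le> int B" "2 ^ N \<le> int B"
  using B_bounds(2,3,4) B_bounds(5)[THEN of_nat_mono, where 'a = int] by simp_all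

lemma runs_log_loop:
  "runs L B log_loop (reduction_state \<phi> n D 0 1 0 (\<lambda>_. 0)) (reduction_state \<phi> n D N (2 ^ N) 0 (\<lambda>_. 0))"
proof -
  define S where "S i = reduction_state \<phi> n D (int i) (2 ^ i) 0 (\<lambda>_. 0)" for i
  \<comment> \<open>The doubling stops at the first power of two that is at least
    \<open>n + 1\<close>, so the loop count is the rounded-up logarithm.\<close>
  have less: "2 ^ i < int n + 1 \<longleftrightarrow> i < N" for i
  proof -
    have "i < N \<longleftrightarrow> 2 ^ i < n + 1"
      using ceillog2_le_iff[of "n + 1" i] unfolding N_def by linarith
    also have "\<dots> \<longleftrightarrow> int (2 ^ i) < int (n + 1)" by (rule of_nat_less_iff[symmetric])
    finally show ?thesis by (simp only: of_nat_power of_nat_add of_nat_numeral of_nat_1)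
  qed
  have pow: "2 ^ i \<le> int B" if "i \<le> N" for i
    by (rule order_trans[OF power_increasing[OF that] bounds_int(4)]) simp
  \<comment> \<open>Between the two assignments of the body the power is one step ahead of the
    counter, hence the two separate indices.\<close>
  have bounded: "bounded_state B (reduction_state \<phi> n D (int i) (2 ^ j) 0 (\<lambda>_. 0))"
    if "i \<le> N" "j \<le> N" for i j
    using bounds_int pow[OF that(2)] that(1) by (intro bounded_reduction_state) auto
  have "runs L B log_loop (S 0) (S N)"
    unfolding log_loop_def
  proof (rule runs_While[OF L B_bounds(1) _ B_bounds(4)])
    fix i assume i: "i < N"
    show "runs L B (Seq (Assign 4 (Bin OpMul (Reg 4) (Lit 2))) (Assign 3 (Bin OpAdd (Reg 3) (Lit 1))))
        (S i) (S (Suc i))"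
      unfolding S_def
      by (rule runs_Seq[OF B_bounds(1)]; rule runs_update, rule bounded) (use i in auto)
  qed (use less bounded in \<open>auto simp: S_def\<close>)
  then show ?thesis by (simp add: S_def)
qed

lemma runs_header_prog:
  "runs L B (header_prog c) (reduction_state \<phi> n D N b 0 (\<lambda>_. 0))
    (reduction_state \<phi> n D N b 0 (prefix_tape xs 5))"
  if b: "\<bar>b\<bar> \<le> int B"
proof -
  have len: "5 \<le> length xs" by (simp add: length_xs)
  define S where "S k = reduction_state \<phi> n D N b 0 (prefix_tape xs k)" for k
  have store: "runs L B (Store 1 (Lit i) e) (S k) (S k')"
    if "k < 5" "simple_expr e" "value_of (S k) e = xs ! k" "k' = Suc k" "i = int k" for k k' e i
  proof -
    have "bounded_state B (S k)"
      unfolding S_def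
      using bounds_int b len that(1) by (intro bounded_reduction_state abs_prefix_tape_le) auto
    then show ?thesis
      unfolding S_def that(4) prefix_tape_Suc[symmetric]
      by (rule runs_update(6)) (use that in \<open>auto simp: S_def\<close>)
  qed
  have "xs ! 0 = int c * (3 + 3 * int N)" "xs ! 1 = int n + 1" "xs ! 2 = int D" "xs ! 3 = int c + 1"
    "xs ! 4 = int c"
    by (simp_all add: xs_def enc_svp_sat_instance[OF c] sat_param_def N_def n_def D_def)
  note header = this
  have
    "runs L B (Store 1 (Lit 0) (Bin OpMul (Lit (int c)) (Bin OpAdd (Lit 3) (Bin OpMul (Lit 3) (Reg 3)))))
      (S 0) (S 1)"
    "runs L B (Store 1 (Lit 1) (Bin OpAdd (Reg 1) (Lit 1))) (S 1) (S 2)"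
    "runs L B (Store 1 (Lit 2) (Reg 2)) (S 2) (S 3)"
    "runs L B (Store 1 (Lit 3) (Lit (int c + 1))) (S 3) (S 4)"
    "runs L B (Store 1 (Lit 4) (Lit (int c))) (S 4) (S 5)"
    by (rule store; simp add: header[simplified] S_def)+
  then have "runs L B (header_prog c) (S 0) (S 5)"
    unfolding header_prog_def by - (assumption | rule runs_Seq[OF B_bounds(1)])+
  moreover have "prefix_tape xs 0 = (\<lambda>_. 0)" by (simp add: prefix_tape_def fun_eq_iff)
  ultimately show ?thesis by (simp add: S_def)
qed

lemma runs_matrix_loop:
  "runs L B matrix_loop (reduction_state \<phi> n D N b 0 (prefix_tape xs 5))
    (reduction_state \<phi> n D N b ((n + 1) * D) (prefix_tape xs (length xs)))"
  if b: "\<bar>b\<bar> \<le> int B"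
proof -
  define R where "R q f = reduction_state \<phi> n D N b (int q) f" for q f
  \<comment> \<open>After \<open>q\<close> cells the output consists of the header and
    \<open>q\<close> pairs.\<close>
  define S where "S q = R q (prefix_tape xs (5 + 2 * q))" for q
  have bounded: "bounded_state B (R q (prefix_tape xs k))" if "q \<le> (n + 1) * D" "k \<le> length xs" for q k
    unfolding R_def
    using bounds_int b that B_bounds(6) by (intro bounded_reduction_state abs_prefix_tape_le) auto
  have "runs L B matrix_loop (S 0) (S ((n + 1) * D))"
    unfolding matrix_loop_def
  proof (rule runs_While[OF L B_bounds(1) _ B_bounds(6)])
    fix q assume q: "q < (n + 1) * D"
    let ?k = "5 + 2 * q"
    have len: "Suc (Suc ?k) \<le> length xs" using q by (simp add: length_xs)
    \<comment> \<open>The output array \<open>f\<close> is arbitrary, as the entry is computed from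
      registers and the formula alone.\<close>
    have entry: "value_of (R q f) entry_expr = xs ! ?k" for f
      using value_of_entry_expr[of "R q f" \<phi> q] enc_svp_sat_instance_nth(1)[OF c, of q \<phi>] q
      by (simp add: R_def xs_def n_def D_def)
    have one: "xs ! Suc ?k = 1"
      using enc_svp_sat_instance_nth(2)[OF c, of q \<phi>] q by (simp add: xs_def n_def D_def)
    have "runs L B (Store 1 (Bin OpAdd (Lit 5) (Bin OpMul (Lit 2) (Reg 5))) entry_expr)
        (R q (prefix_tape xs ?k)) (R q (prefix_tape xs (Suc ?k)))"
      unfolding prefix_tape_Suc[of xs ?k, symmetric] R_def
      by (rule runs_update(6)) (use bounded q len simple_entry_expr entry in \<open>auto simp: R_def\<close>)
    moreover have "runs L B (Store 1 (Bin OpAdd (Lit 6) (Bin OpMul (Lit 2) (Reg 5))) (Lit 1))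
        (R q (prefix_tape xs (Suc ?k))) (R q (prefix_tape xs (Suc (Suc ?k))))"
      unfolding prefix_tape_Suc[of xs "Suc ?k", symmetric] one R_def
      by (rule runs_update(6)) (use bounded q len in \<open>auto simp: R_def\<close>)
    moreover have "runs L B (Assign 5 (Bin OpAdd (Reg 5) (Lit 1)))
        (R q (prefix_tape xs (Suc (Suc ?k)))) (S (Suc q))"
      unfolding S_def R_def mult_Suc_right add_2_eq_Suc add_Suc_right
      by (rule runs_update(5)) (use bounded[of q "Suc (Suc ?k)"] q len in \<open>auto simp: R_def\<close>)
    ultimately show "runs L B
       (Seq (Store 1 (Bin OpAdd (Lit 5) (Bin OpMul (Lit 2) (Reg 5))) entry_expr)
       (Seq (Store 1 (Bin OpAdd (Lit 6) (Bin OpMul (Lit 2) (Reg 5))) (Lit 1))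
          (Assign 5 (Bin OpAdd (Reg 5) (Lit 1))))) (S q) (S (Suc q))"
      unfolding S_def by - (assumption | rule runs_Seq[OF B_bounds(1)])+
  next
    fix q assume "q \<le> (n + 1) * D"
    then show "bounded_state B (S q)"
      unfolding S_def by (intro bounded) (simp_all add: length_xs)
  next
    fix q assume "q < (n + 1) * D"
    then have "int q < int ((n + 1) * D)" by (rule of_nat_less_iff[THEN iffD2])
    then show "value_of (S q) (Bin OpLess (Reg 5) (Bin OpMul (Bin OpAdd (Reg 1) (Lit 1)) (Reg 2))) \<noteq> 0"
      by (simp add: S_def R_def algebra_simps)
  qed (auto simp: S_def R_def algebra_simps)
  then show ?thesis by (simp add: S_def R_def length_xs)
qed

lemma runs_reduction_prog:
  "runs L B (reduction_prog c) (input_state (enc_cnf3 \<phi>))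
    (reduction_state \<phi> n D N (2 ^ N) ((n + 1) * D) (prefix_tape xs (length xs)))"
proof -
  have bounded: "bounded_state B (reduction_state \<phi> n' d 0 0 0 (\<lambda>_. 0))"
    if "n' \<in> {0, int n}" "d \<in> {0, int D}" for n' d
    using that bounds_int by (intro bounded_reduction_state) auto
  have "runs L B (Assign 1 (Arr 0 (Lit 0))) (reduction_state \<phi> 0 0 0 0 0 (\<lambda>_. 0))
      (reduction_state \<phi> n 0 0 0 0 (\<lambda>_. 0))"
    by (rule runs_update(1)) (use bounded[of 0 0] in \<open>auto simp: sat_tape_header n_def\<close>)
  moreover have "runs L B (Assign 2 (Bin OpAdd (Bin OpAdd (Reg 1) (Lit 1)) (Arr 0 (Lit 1))))
      (reduction_state \<phi> n 0 0 0 0 (\<lambda>_. 0)) (reduction_state \<phi> n D 0 0 0 (\<lambda>_. 0))"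
    by (rule runs_update(2))
      (use bounded[of n 0] in \<open>auto simp: sat_tape_header n_def D_def sat_dim_def\<close>)
  moreover have "runs L B (Assign 4 (Lit 1))
      (reduction_state \<phi> n D 0 0 0 (\<lambda>_. 0)) (reduction_state \<phi> n D 0 1 0 (\<lambda>_. 0))"
    by (rule runs_update(4)) (use bounded[of n D] in auto)
  moreover have "\<bar>2 ^ N\<bar> \<le> int B" using bounds_int by simp
  ultimately show ?thesis
    unfolding reduction_prog_def reduction_state_input
    by - (assumption | rule runs_Seq[OF B_bounds(1)] runs_log_loop runs_header_prog runs_matrix_loop)+
qed

end

section \<open>Composition of the reduction with a solver\<close>

text \<open>Register 0 is kept because it holds the answer; the reduction uses registers 1 to 5.\<close>

definition shift_reg :: "nat \<Rightarrow> nat" where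
  "shift_reg r = (if r = 0 then 0 else r + 5)"

definition sat_solver_prog :: "nat \<Rightarrow> prog \<Rightarrow> prog" where
  "sat_solver_prog c P = Seq (reduction_prog c) (rename_prog shift_reg Suc P)"

lemma inj_shift_reg: "inj shift_reg"
  by (auto simp: shift_reg_def inj_def split: if_splits)

text \<open>Under the renaming, the five working registers and the formula are invisible, and array
  1 becomes array 0. The solver thus finds exactly its initial state.\<close>

lemma view_reduction_state:
  "view shift_reg Suc (reduction_state \<phi> n d a b q (prefix_tape xs (length xs))) = input_state xs"
  by (auto simp: view_def reduction_state_def input_state_def prefix_tape_def shift_reg_def fun_eq_iff)

lemma word_length_pos: "0 < word_length xs"
  unfolding word_length_def by (subst Max_gr_iff) auto

context sat_reduction
begin

lemma bit_length_xs_le: "x \<in> set xs \<Longrightarrow> bit_length x \<le> B ^ 2"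
proof -
  assume "x \<in> set xs"
  then have "bit_length x \<le> B + 1"
    using bit_length_le[of x] abs_set_xs_le[of x] by linarith
  also have "\<dots> \<le> 2 * B" using B_bounds(1) by simp
  also have "\<dots> \<le> B * B" using B_bounds(1) by (rule mult_right_mono) simp
  finally show ?thesis by (simp add: power2_eq_square)
qed

lemma encoding_size_xs_le: "encoding_size xs \<le> B ^ 3"
proof -
  have "encoding_size xs \<le> (\<Sum>x\<leftarrow>xs. B ^ 2)"
    unfolding encoding_size_def by (intro sum_list_mono bit_length_xs_le)
  also have "\<dots> = length xs * B ^ 2" by (simp add: sum_list_triv)
  also have "\<dots> \<le> B * B ^ 2" using B_bounds(7) by (intro mult_right_mono) auto
  finally show ?thesis by (simp add: power3_eq_cube power2_eq_square)
qed

lemma word_length_xs_le: "word_length xs \<le> B ^ 3"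
proof -
  have "word_length xs \<le> B ^ 2"
    unfolding word_length_def using bit_length_xs_le B_bounds(1) by auto
  also have "\<dots> \<le> B ^ 3" using B_bounds(1) by (intro power_increasing) auto
  finally show ?thesis .
qed

end

text \<open>The first summand pays for the reduction. The factor in front of \<open>T\<close> bounds
  the word length of the lattice encoding, the price of charging the solver at the word length of
  the formula.\<close>

lemma answers_within_sat_solver_prog:
  assumes "valid_cnf3 \<phi>" "1 \<le> c" "answers_within P (enc_svp (sat_instance c \<phi>)) T ans"
  shows "answers_within (sat_solver_prog c P) (enc_cnf3 \<phi>)
    (real (size_bound c (num_vars \<phi>)) ^ prog_degree (reduction_prog c) +
     real (size_bound c (num_vars \<phi>)) ^ 3 * T) ans"
proof -
  let ?L = "word_length (enc_cnf3 \<phi>)"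
  interpret sat_reduction \<phi> c ?L
    using assms(1,2) word_length_pos by unfold_locales
  obtain t s where exec: "exec (word_length xs) P (input_state xs) t s"
    and t: "real t \<le> T" and ans: "regs s 0 \<noteq> 0 \<longleftrightarrow> ans"
    using assms(3) unfolding answers_within_def xs_def by blast
  obtain u where u: "exec ?L P (input_state xs) u s" "u \<le> word_length xs * t"
    using exec_rescale[OF exec L word_length_pos] by blast
  define S where "S = reduction_state \<phi> n D N (2 ^ N) ((n + 1) * D) (prefix_tape xs (length xs))"
  obtain r where r: "exec ?L (reduction_prog c) (input_state (enc_cnf3 \<phi>)) r S"
    "r \<le> B ^ prog_degree (reduction_prog c)"
    using runs_reduction_prog unfolding runs_def S_def by blast
  obtain s' where s': "exec ?L (rename_prog shift_reg Suc P) S u s'" "view shift_reg Suc s' = s"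
    using exec_rename[OF u(1) inj_shift_reg, of Suc S] view_reduction_state unfolding S_def by auto
  have "regs s' 0 = regs s 0" using s'(2) by (auto simp: view_def shift_reg_def)
  moreover have "exec ?L (sat_solver_prog c P) (input_state (enc_cnf3 \<phi>)) (r + u) s'"
    unfolding sat_solver_prog_def by (rule exec.Seq[OF r(1) s'(1)])
  moreover have "real (r + u) \<le> real B ^ prog_degree (reduction_prog c) + real B ^ 3 * T"
  proof -
    have "real r \<le> real B ^ prog_degree (reduction_prog c)"
      using r(2) by (metis of_nat_le_iff of_nat_power)
    moreover have "real u \<le> real (word_length xs) * real t"
      using u(2) by (metis of_nat_le_iff of_nat_mult)
    moreover have "real (word_length xs) \<le> real B ^ 3"
      using word_length_xs_le by (metis of_nat_le_iff of_nat_power)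
    then have "real (word_length xs) * real t \<le> real B ^ 3 * T"
      using t by (intro mult_mono) auto
    ultimately show ?thesis unfolding of_nat_add by linarith
  qed
  ultimately show ?thesis
    using ans unfolding answers_within_def B_def n_def by metis
qed

lemma answers_within_mono: "answers_within P xs T ans \<Longrightarrow> T \<le> T' \<Longrightarrow> answers_within P xs T' ans"
  unfolding answers_within_def by fastforce

section \<open>Asymptotics\<close>

text \<open>A polynomial factor adds only a logarithm to the exponent of the running time.\<close>

lemma log_size_bound_smallo: "(\<lambda>n. log 2 (size_bound c n)) \<in> o(\<lambda>n. real n)"
proof -
  define C where "C = 3 * real c + 21"
  have "C > 0" by (simp add: C_def add_nonneg_pos)
  then have "(\<lambda>n. log 2 (C * (real n + 1) ^ 4)) \<in> o(\<lambda>n. real n)"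
    by real_asymp
  then show ?thesis by (simp add: size_bound_def C_def add.commute)
qed

lemma sat_param_le: "real (sat_param c n) \<le> 6 * c + 3 * c * log 2 (real n + 1)"
proof -
  have "real (ceillog2 (n + 1)) \<le> log 2 (real n + 1) + 1"
    using ceillog2_less_log[of "n + 1"] by (simp add: add.commute)
  then have "real c * (3 + 3 * real (ceillog2 (n + 1))) \<le> real c * (3 + 3 * (log 2 (real n + 1) + 1))"
    by (intro mult_left_mono) auto
  then show ?thesis by (simp add: sat_param_def algebra_simps)
qed

text \<open>Lets an asymptotic statement in the norm parameter be read as one in the number of
  variables.\<close>

lemma filterlim_sat_param:
  assumes "1 \<le> c"
  shows "filterlim (sat_param c) at_top at_top"
proof -
  have "filterlim (\<lambda>n. log 2 (real n + 1)) at_top at_top" by real_asymp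
  moreover have "log 2 (real n + 1) \<le> real (sat_param c n)" for n
  proof -
    have "log 2 (real n + 1) \<le> real (ceillog2 (n + 1))"
      using ceillog2_ge_log[of "n + 1"] by (simp add: add.commute)
    also have "ceillog2 (n + 1) \<le> sat_param c n"
      using mult_right_mono[OF assms, of "3 + 3 * ceillog2 (n + 1)", OF le0]
      unfolding sat_param_def mult_1 by linarith
    finally show ?thesis by simp
  qed
  ultimately have "filterlim (\<lambda>n. real (sat_param c n)) at_top at_top"
    by (rule filterlim_at_top_mono[OF _ always_eventually[OF allI]])
  then show ?thesis by (rule filterlim_sequentially_iff_filterlim_real[THEN iffD2])
qed

text \<open>The parameter is at most \<open>6 * c + 3 * c * log 2 (n + 1)\<close>, so a sublinear
  \<open>f\<close> is eventually at most \<open>1 + log 2 (n + 1) / 2\<close>, and its power of two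
  is at most twice the square root of \<open>n + 1\<close>.\<close>

lemma powr_sat_param_smallo:
  assumes "1 \<le> c" "f \<in> o(\<lambda>p. real p)"
  shows "(\<lambda>n. 2 powr f (sat_param c n)) \<in> o(\<lambda>n. real n)"
proof -
  \<comment> \<open>This constant turns the coefficient of the logarithm into 1/2; any coefficient
    below 1 would give a sublinear power.\<close>
  have "0 < 1 / (6 * real c)" using assms(1) by simp
  from landau_o.smallD[OF assms(2) this]
  have "eventually (\<lambda>n. norm (f (sat_param c n)) \<le> 1 / (6 * real c) * norm (real (sat_param c n))) at_top"
    using filterlim_sat_param[OF assms(1)] by (rule eventually_compose_filterlim)
  then have "eventually (\<lambda>n. norm (2 powr f (sat_param c n)) \<le> 1 * norm (2 powr (1 + log 2 (real n + 1) / 2))) at_top"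
  proof eventually_elim
    case (elim n)
    have "f (sat_param c n) \<le> 1 / (6 * real c) * real (sat_param c n)" using elim by simp
    also have "\<dots> \<le> 1 / (6 * real c) * (6 * c + 3 * c * log 2 (real n + 1))"
      using sat_param_le by (intro mult_left_mono) auto
    also have "\<dots> = 1 + log 2 (real n + 1) / 2" using assms(1) by (simp add: field_simps)
    finally show ?case by simp
  qed
  then have "(\<lambda>n. 2 powr f (sat_param c n)) \<in> O(\<lambda>n. 2 powr (1 + log 2 (real n + 1) / 2))"
    by (rule bigoI)
  also have "(\<lambda>n. 2 powr (1 + log 2 (real n + 1) / 2)) \<in> o(\<lambda>n. real n)"
    by real_asymp
  finally show ?thesis .
qed

text \<open>The rank exceeds the number of variables by one. The absolute value keeps the exponent
  nonnegative.\<close>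

lemma Suc_smallo:
  assumes "g \<in> o(\<lambda>n. real n)"
  shows "(\<lambda>n. \<bar>g (n + 1)\<bar> :: real) \<in> o(\<lambda>n. real n)"
proof -
  have "(\<lambda>n. g (n + 1)) \<in> o(\<lambda>n. real (n + 1))"
    using assms by (rule landau_o.small.compose) real_asymp
  also have "(\<lambda>n. real (n + 1)) \<in> O(\<lambda>n. real n)" by real_asymp
  finally show ?thesis by simp
qed

section \<open>Contradiction with the Exponential Time Hypothesis\<close>

theorem theorem1p4:
  fixes \<epsilon> :: real
  assumes "0 < \<epsilon>" and "\<epsilon> \<le> 1" and "ETH"
  shows "\<not> (\<exists>P f g k. f \<in> o(\<lambda>p. real p) \<and> g \<in> o(\<lambda>n. real n) \<and>
           solves_in_time P enc_svp (gap_svp_par (2 - \<epsilon>))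
             (\<lambda>I. 2 powr (2 powr f (norm_param I)) * 2 powr g (svp_rank I) *
                   real (encoding_size (enc_svp I)) ^ k))"
proof
  assume "\<exists>P f g k. f \<in> o(\<lambda>p. real p) \<and> g \<in> o(\<lambda>n. real n) \<and>
           solves_in_time P enc_svp (gap_svp_par (2 - \<epsilon>))
             (\<lambda>I. 2 powr (2 powr f (norm_param I)) * 2 powr g (svp_rank I) *
                   real (encoding_size (enc_svp I)) ^ k)"
  then obtain P f g k where f: "f \<in> o(\<lambda>p. real p)" and g: "g \<in> o(\<lambda>n. real n)"
    and solves: "solves_in_time P enc_svp (gap_svp_par (2 - \<epsilon>))
             (\<lambda>I. 2 powr (2 powr f (norm_param I)) * 2 powr g (svp_rank I) *
                   real (encoding_size (enc_svp I)) ^ k)" by blast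
  \<comment> \<open>The gap requires \<open>2 - \<epsilon> < c * \<epsilon>\<close>, and this choice
    gives \<open>2 \<le> c * \<epsilon>\<close>.\<close>
  define c where "c = nat \<lceil>2 / \<epsilon>\<rceil>"
  have c_ge: "2 / \<epsilon> \<le> real c" unfolding c_def by (rule real_nat_ceiling_ge)
  moreover have "0 < 2 / \<epsilon>" using assms(1) by simp
  ultimately have c: "1 \<le> c" by linarith
  have gap: "(2 - \<epsilon>) * (1 + 1 / real c) < 2"
  proof -
    have "2 \<le> real c * \<epsilon>" using c_ge assms(1) by (simp add: field_simps)
    then show ?thesis using c assms(1) by (simp add: field_simps)
  qed
  \<comment> \<open>The degrees are those of the reduction, of the change of word length (3) and of
    the encoding size to the power \<open>k\<close> (\<open>3 * k\<close>). The final 1 pays for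
    adding two powers of \<open>B\<close>.\<close>
  define M where "M = prog_degree (reduction_prog c) + (3 + 3 * k) + 1"
  define G where "G n = real M * log 2 (size_bound c n) + 2 powr f (sat_param c n) + \<bar>g (n + 1)\<bar>" for n
  have "G \<in> o(\<lambda>n. real n)"
    unfolding G_def
    by (intro sum_in_smallo landau_o.small.cmult_in_iff'[THEN iffD2] disjI2
        log_size_bound_smallo powr_sat_param_smallo Suc_smallo f g c) (simp add: log_size_bound_smallo)
  moreover have "answers_within (sat_solver_prog c P) (enc_cnf3 \<phi>) (2 powr G (num_vars \<phi>)) (satisfiable \<phi>)"
    if valid: "valid_cnf3 \<phi>" for \<phi>
  proof -
    \<comment> \<open>Only bounds on the size of the instance are drawn from this interpretation,
      and they are the same for every word length.\<close>
    interpret sat_reduction \<phi> c 1 using valid c by unfold_locales auto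
    let ?I = "sat_instance c \<phi>"
    define T where "T = 2 powr (2 powr f (norm_param ?I)) * 2 powr g (svp_rank ?I) *
      real (encoding_size (enc_svp ?I)) ^ k"
    have thr: "real_of_rat (threshold ?I) = 1 + 1 / real c"
      by (simp add: sat_instance_def of_rat_add of_rat_divide)
    have "answers_within P (enc_svp ?I) T (satisfiable \<phi>)"
    proof (cases "satisfiable \<phi>")
      case True
      then have "?I \<in> fst (gap_svp_par (2 - \<epsilon>))"
        using valid_svp_sat_instance[OF valid c] svp_lambda1_sat_instance(1)[OF valid c] thr
        by (simp add: gap_svp_par_def)
      then show ?thesis using solves True unfolding solves_in_time_def T_def by auto
    next
      case False
      then have "?I \<in> snd (gap_svp_par (2 - \<epsilon>))"
        using valid_svp_sat_instance[OF valid c] svp_lambda1_sat_instance(2)[OF valid c] thr gap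
        by (simp add: gap_svp_par_def)
      then show ?thesis using solves False unfolding solves_in_time_def T_def by auto
    qed
    from answers_within_sat_solver_prog[OF valid c this]
    have "answers_within (sat_solver_prog c P) (enc_cnf3 \<phi>)
      (real B ^ prog_degree (reduction_prog c) + real B ^ 3 * T) (satisfiable \<phi>)"
      by (simp add: B_def n_def)
    moreover have "real B ^ prog_degree (reduction_prog c) + real B ^ 3 * T \<le> 2 powr G n"
    proof -
      define E where "E = 2 powr (2 powr f (sat_param c n) + \<bar>g (n + 1)\<bar>)"
      \<comment> \<open>Allows the time of the reduction to be multiplied by \<open>E\<close> as
        well, so that \<open>E\<close> can be factored out of the sum.\<close>
      have "1 \<le> E" unfolding E_def by (intro ge_one_powr_ge_zero) auto
      have "T = 2 powr (2 powr f (sat_param c n) + g (n + 1)) * real (encoding_size xs) ^ k"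
        by (simp add: T_def sat_instance_def svp_rank_def sat_basis_def n_def xs_def powr_add)
      also have "\<dots> \<le> E * (real B ^ 3) ^ k"
      proof (intro mult_mono power_mono)
        show "real (encoding_size xs) \<le> real B ^ 3"
          using encoding_size_xs_le by (metis of_nat_le_iff of_nat_power)
      qed (auto simp: E_def)
      finally have "real B ^ 3 * T \<le> real B ^ 3 * (E * (real B ^ 3) ^ k)"
        by (intro mult_left_mono) auto
      also have "\<dots> = real B ^ (3 + 3 * k) * E" by (simp add: power_add power_mult)
      finally have "real B ^ prog_degree (reduction_prog c) + real B ^ 3 * T
          \<le> real B ^ prog_degree (reduction_prog c) * E + real B ^ (3 + 3 * k) * E"
        using mult_left_mono[OF \<open>1 \<le> E\<close>, of "real B ^ prog_degree (reduction_prog c)"] by simp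
      also have "\<dots> = (real B ^ prog_degree (reduction_prog c) + real B ^ (3 + 3 * k)) * E"
        by (simp add: distrib_right)
      also have "\<dots> \<le> real B ^ M * E"
        unfolding M_def using B_bounds(1) \<open>1 \<le> E\<close>
        by (intro mult_right_mono power_add_le) auto
      \<comment> \<open>The polynomial factor moves into the exponent, as the first summand of
        \<open>G\<close>.\<close>
      also have "real B ^ M = 2 powr (real M * log 2 (real B))"
        using B_bounds(1) by (subst mult.commute) (simp add: powr_powr[symmetric] powr_realpow)
      finally show ?thesis
        by (simp add: E_def G_def B_def powr_add add.assoc mult.assoc)
    qed
    ultimately show ?thesis
      unfolding n_def by (rule answers_within_mono)
  qed
  then have "solves_in_time (sat_solver_prog c P) enc_cnf3 three_sat (\<lambda>\<phi>. 2 powr G (num_vars \<phi>))"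
    unfolding solves_in_time_def three_sat_def by fastforce
  ultimately show False using assms(3) unfolding ETH_def by blast
qed

end
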